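(* Let $n\ge1$ and let $V$ be a lattice of $(\mathbf R_{>0})^n$ such that the map $v=(v_1,\dots,v_n)\mapsto v_n$ is injective on $V$. Then there exists an effective Shintani decomposition of $(\mathbf R_{>0})^n$ modulo $V$.
   Context: A lattice of $(\mathbf R_{>0})^n$ is a subgroup $V$ (for coordinatewise multiplication) such that $\mathrm{Log}:(z_1,\dots,z_n)\mapsto(\log|z_1|,\dots,\log|z_n|)$ induces an isomorphism of $V$ onto a lattice of the hyperplane $\{x\in\mathbf R^n:\ \sum_ix_i=0\}$. Let $e_1,\dots,e_n$ be the canonical basis of $\mathbf R^n$. If $B=(f_1,\dots,f_n)$ is a basis of $\mathbf R^n$ such that $e_n$ belongs to none of the hyperplanes spanned by $n-1$ of the vectors $f_1,\dots,f_n$, let $C_B^0=\{\sum_it_if_i:\ t_i>0\}$ and let $C_B$ be the cone whose characteristic function is $\mathbf 1_{C_B}(x)=\lim_{t\to0^+}\mathbf 1_{C_B^0}(x+te_n)$. An effective Shintani decomposition of $(\mathbf R_{>0})^n$ modulo $V$ is a finite set $\mathcal B$ of bases of $\mathbf R^n$ consisting of elements of $(\mathbf R_{>0})^n$ such that: (i) if $B=(f_1,\dots,f_n)\in\mathcal B$, then $e_n$ belongs to none of the hyperplanes spanned by $n-1$ of the vectors $f_1,\dots,f_n$; (ii) for every $x\in(\mathbf R_{>0})^n$ there is exactly one pair $(B,v)\in\mathcal B\times V$ such that $vx\in C_B$. *)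

theory Defs
  imports "HOL-Analysis.Analysis"
begin

text \<open>
  \<open>real^'n\<close> plays the role of \<open>R^n\<close> with \<open>n = CARD('n) \<ge> 1\<close>. Its library product \<open>v * w\<close> is
  the coordinatewise one, with unit \<open>1\<close>. An index type carries no order, so the last coordinate is
  represented by a parameter \<open>l :: 'n\<close>, and \<open>e_n\<close> by \<open>axis l 1\<close>.
\<close>

definition pos_orthant :: "(real^'n) set" where
  "pos_orthant = {x. \<forall>i. x $ i > 0}"

definition Log :: "real^'n \<Rightarrow> real^'n" where
  "Log z = (\<chi> i. ln \<bar>z $ i\<bar>)"

definition sum_zero_hyperplane :: "(real^'n) set" where
  "sum_zero_hyperplane = {x. (\<Sum>i\<in>UNIV. x $ i) = 0}"

text \<open>A lattice of a finite-dimensional real vector space \<open>H\<close> is a discrete additive subgroup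
  of \<open>H\<close> that spans \<open>H\<close> over \<open>R\<close>.\<close>

definition lattice_in :: "'a::euclidean_space set \<Rightarrow> 'a set \<Rightarrow> bool" where
  "lattice_in H L \<longleftrightarrow>
     0 \<in> L \<and> (\<forall>x\<in>L. \<forall>y\<in>L. x + y \<in> L) \<and> (\<forall>x\<in>L. - x \<in> L) \<and>
     discrete L \<and> L \<subseteq> H \<and> span L = H"

definition pos_subgroup :: "(real^'n) set \<Rightarrow> bool" where
  "pos_subgroup V \<longleftrightarrow>
     V \<subseteq> pos_orthant \<and> 1 \<in> V \<and> (\<forall>v\<in>V. \<forall>w\<in>V. v * w \<in> V) \<and>
     (\<forall>v\<in>V. (\<chi> i. inverse (v $ i)) \<in> V)"

definition pos_lattice :: "(real^'n) set \<Rightarrow> bool" where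
  "pos_lattice V \<longleftrightarrow> pos_subgroup V \<and>
     (\<exists>L. lattice_in sum_zero_hyperplane L \<and> bij_betw Log V L \<and>
          (\<forall>v\<in>V. \<forall>w\<in>V. Log (v * w) = Log v + Log w))"

definition is_basis :: "('n \<Rightarrow> real^'n) \<Rightarrow> bool" where
  "is_basis f \<longleftrightarrow> inj f \<and> independent (range f) \<and> span (range f) = UNIV"

definition generic_for :: "'n \<Rightarrow> ('n \<Rightarrow> real^'n) \<Rightarrow> bool" where
  "generic_for l f \<longleftrightarrow> (\<forall>i. axis l 1 \<notin> span (f ` (UNIV - {i})))"

definition open_cone :: "('n \<Rightarrow> real^'n) \<Rightarrow> (real^'n) set" where
  "open_cone f = {(\<Sum>i\<in>UNIV. t i *\<^sub>R f i) | t. \<forall>i. t i > 0}"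

text \<open>The cone \<open>C_B\<close>. A set is determined by the points where its characteristic function is 1; that
  the limit exists everywhere and is the characteristic function of this set, when \<open>f\<close> is a basis
  generic for \<open>l\<close>, is \<open>indicator_shifted_cone\<close> below.\<close>

definition shifted_cone :: "'n \<Rightarrow> ('n \<Rightarrow> real^'n) \<Rightarrow> (real^'n) set" where
  "shifted_cone l f =
     {x. ((\<lambda>t. indicator (open_cone f) (x + t *\<^sub>R axis l 1)) \<longlongrightarrow> (1::real)) (at_right 0)}"

definition effective_shintani_decomposition ::
    "'n \<Rightarrow> (real^'n) set \<Rightarrow> ('n \<Rightarrow> real^'n) set \<Rightarrow> bool" where
  "effective_shintani_decomposition l V \<B> \<longleftrightarrow>
     finite \<B> \<and>
     (\<forall>f\<in>\<B>. is_basis f \<and> range f \<subseteq> pos_orthant) \<and>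
     (\<forall>f\<in>\<B>. generic_for l f) \<and>
     (\<forall>x\<in>pos_orthant. \<exists>!p. p \<in> \<B> \<times> V \<and> snd p * x \<in> shifted_cone l (fst p))"

lemma open_cone_iff:
  assumes "is_basis f"
  shows "x \<in> open_cone f \<longleftrightarrow> (\<forall>i. representation (range f) x (f i) > 0)"
proof -
  have inj: "inj f" and ind: "independent (range f)" and sp: "span (range f) = UNIV"
    using assms by (auto simp: is_basis_def)
  have rep: "representation (range f) (\<Sum>i\<in>UNIV. t i *\<^sub>R f i) (f j) = t j" for t j
  proof -
    have "representation (range f) (\<Sum>i\<in>UNIV. t i *\<^sub>R f i) (f j) =
          (\<Sum>i\<in>UNIV. representation (range f) (t i *\<^sub>R f i) (f j))"
      using ind sp by (subst real_vector.representation_sum) auto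
    also have "\<dots> = (\<Sum>i\<in>UNIV. t i * (if i = j then 1 else 0))"
      using ind sp inj
      by (intro sum.cong)
        (auto simp: real_vector.representation_scale real_vector.representation_basis inj_eq)
    also have "\<dots> = t j"
      by (subst sum.remove[of UNIV j]) simp_all
    finally show ?thesis .
  qed
  have "x = (\<Sum>i\<in>UNIV. representation (range f) x (f i) *\<^sub>R f i)"
    using real_vector.sum_representation_eq[OF ind, of x "range f"] sp inj
    by (simp add: sum.reindex)
  then show ?thesis
    unfolding open_cone_def using rep by (auto 4 3)
qed

lemma indicator_shifted_cone:
  assumes "is_basis f" "generic_for l f"
  shows "((\<lambda>t. indicator (open_cone f) (x + t *\<^sub>R axis l 1))
           \<longlongrightarrow> (indicator (shifted_cone l f) x :: real)) (at_right 0)"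
proof -
  let ?e = "axis l 1 :: real^'a"
  let ?c = "\<lambda>y i. representation (range f) y (f i)"
  have inj: "inj f" and ind: "independent (range f)" and sp: "span (range f) = UNIV"
    using assms by (auto simp: is_basis_def)
  have nz: "?c ?e i \<noteq> 0" for i
  proof
    assume 0: "?c ?e i = 0"
    have "?e = (\<Sum>j\<in>UNIV. ?c ?e j *\<^sub>R f j)"
      using real_vector.sum_representation_eq[OF ind, of ?e "range f"] sp inj
      by (simp add: sum.reindex)
    also have "\<dots> = (\<Sum>j\<in>UNIV - {i}. ?c ?e j *\<^sub>R f j)"
      using 0 by (intro sum.mono_neutral_right) auto
    also have "\<dots> \<in> span (f ` (UNIV - {i}))"
      by (intro span_sum span_scale span_base) auto
    finally show False using assms(2) by (auto simp: generic_for_def)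
  qed
  have lin: "?c (x + t *\<^sub>R ?e) i = ?c x i + t * ?c ?e i" for t i
    using ind sp by (simp add: real_vector.representation_add real_vector.representation_scale)
  have sgn: "\<exists>b. \<forall>\<^sub>F t in at_right 0. (?c (x + t *\<^sub>R ?e) i > 0) = b" for i
  proof (cases "?c x i = 0")
    case True
    have "\<forall>\<^sub>F t in at_right (0::real). (?c (x + t *\<^sub>R ?e) i > 0) = (?c ?e i > 0)"
      using eventually_at_right_less[of "0::real"]
      by eventually_elim (simp add: lin True zero_less_mult_iff)
    then show ?thesis by blast
  next
    case False
    have "((\<lambda>t. ?c (x + t *\<^sub>R ?e) i) \<longlongrightarrow> ?c x i + 0 * ?c ?e i) (at_right 0)"
      unfolding lin by (intro tendsto_intros)
    then have lim: "((\<lambda>t. ?c (x + t *\<^sub>R ?e) i) \<longlongrightarrow> ?c x i) (at_right 0)" by simp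
    show ?thesis
    proof (cases "?c x i > 0")
      case True
      then show ?thesis using order_tendstoD(1)[OF lim, of 0] by (intro exI[of _ True]) auto
    next
      case neg: False
      have "\<forall>\<^sub>F t in at_right 0. ?c (x + t *\<^sub>R ?e) i < 0"
        using order_tendstoD(2)[OF lim, of 0] neg False by auto
      then show ?thesis by (intro exI[of _ False]) (auto elim: eventually_mono)
    qed
  qed
  then obtain b where "\<forall>\<^sub>F t in at_right 0. (?c (x + t *\<^sub>R ?e) i > 0) = b i" for i by metis
  then have "\<forall>\<^sub>F t in at_right 0. \<forall>i. (?c (x + t *\<^sub>R ?e) i > 0) = b i"
    by (intro eventually_all_finite) auto
  then have ev: "\<forall>\<^sub>F t in at_right 0.
      indicator (open_cone f) (x + t *\<^sub>R ?e) = (if \<forall>i. b i then 1 else (0::real))"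
    by eventually_elim (auto simp: open_cone_iff[OF assms(1)] indicator_def)
  have lim: "((\<lambda>t. indicator (open_cone f) (x + t *\<^sub>R ?e))
      \<longlongrightarrow> (if \<forall>i. b i then 1 else (0::real))) (at_right 0)"
    by (rule tendsto_eventually[OF ev])
  show ?thesis
  proof (cases "x \<in> shifted_cone l f")
    case True
    then show ?thesis by (simp add: shifted_cone_def)
  next
    case False
    have "\<not> (\<forall>i. b i)"
    proof
      assume "\<forall>i. b i"
      with lim have "x \<in> shifted_cone l f" by (simp add: shifted_cone_def)
      with False show False ..
    qed
    then have "(if \<forall>i. b i then 1 else (0::real)) = indicator (shifted_cone l f) x"
      using False by auto
    then show ?thesis using lim by (simp only:)
  qed
qed

end

theory Submission
  imports Defs
begin

text \<open>
  Let \<open>S\<close> be a union of finitely many \<open>V\<close>-orbits in the positive orthant and \<open>P\<close> the set of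
  functionals \<open>h\<close> with \<open>h \<ge> 1\<close> on \<open>S\<close>. By linear programming duality, every \<open>x\<close> in the orthant lies in
  the cone spanned by the points of \<open>S\<close> where \<open>h = 1\<close>, for \<open>h \<in> P\<close> minimizing \<open>h \<bullet> x\<close>. These are the cones
  over the compact faces of the convex hull of \<open>S\<close>; they form a \<open>V\<close>-invariant fan, locally finite in
  the open orthant and finite modulo \<open>V\<close>. If \<open>S\<close> is in general position, the fan is simplicial and no
  hyperplane spanned by a facet of a cone contains \<open>e_n\<close>, so the points \<open>x + t e_n\<close> with \<open>t\<close> small and
  positive all lie in the same open cone.

  Perturbing the orbit representatives achieves general position only for points in distinct orbits.
  So \<open>S\<close> is first chosen dense on the surface \<open>\<Prod>x_i = 1\<close>: the stability of the AM-GM inequality then makes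
  each face so small that it cannot contain two points of one orbit.
\<close>

section \<open>Simplicial cones\<close>

definition orbits :: "(real^'n) set \<Rightarrow> (real^'n) set \<Rightarrow> (real^'n) set" where
  "orbits V G = {v * g | v g. v \<in> V \<and> g \<in> G}"

text \<open>In the positive orthant this says that \<open>T\<close> contains at most one point of
  each \<open>V\<close>-orbit. Points of one orbit move together when a representative is perturbed,
  so general position is only asked of such sets.\<close>

definition transversal :: "(real^'n) set \<Rightarrow> (real^'n) set \<Rightarrow> bool" where
  "transversal V T \<longleftrightarrow> (\<forall>s\<in>T. \<forall>v\<in>V. v * s \<in> T \<longrightarrow> v = 1)"

definition dual_poly :: "'a::real_inner set \<Rightarrow> 'a set" where
  "dual_poly S = {h. \<forall>s\<in>S. 1 \<le> h \<bullet> s}"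

definition active :: "'a::real_inner set \<Rightarrow> 'a \<Rightarrow> 'a set" where
  "active S h = {s\<in>S. h \<bullet> s = 1}"

definition simplicial_cone :: "'a::real_vector set \<Rightarrow> 'a set" where
  "simplicial_cone T = {(\<Sum>s\<in>T. u s *\<^sub>R s) | u. \<forall>s\<in>T. u s > 0}"

text \<open>Attached to a set of vertices instead of an indexed basis, so that \<open>V\<close> can
  act on cells by images.\<close>

definition shifted_simplicial_cone :: "'n \<Rightarrow> (real^'n) set \<Rightarrow> (real^'n) set" where
  "shifted_simplicial_cone l T =
     {x. \<exists>d>0. \<forall>t. 0 < t \<longrightarrow> t < d \<longrightarrow> x + t *\<^sub>R axis l 1 \<in> simplicial_cone T}"

definition vinv :: "real^'n \<Rightarrow> real^'n" where
  "vinv v = (\<chi> i. inverse (v $ i))"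

lemma vinv_component [simp]: "vinv v $ i = inverse (v $ i)"
  by (simp add: vinv_def)

lemma vinv_mult_cancel:
  assumes "\<And>i. v $ i \<noteq> 0"
  shows "vinv v * (v * x) = x" "v * (vinv v * x) = x"
  using assms by (simp_all add: vec_eq_iff)

lemma linear_mult_left_vec: "linear (\<lambda>x::real^'n. v * x)"
  by (rule linearI) (simp_all add: algebra_simps)

lemma inner_vec_sum: "x \<bullet> y = (\<Sum>i\<in>UNIV. x $ i * y $ i)" for x y :: "real^'n"
  by (simp add: inner_vec_def)

lemma inner_mult_vec: "(v * x) \<bullet> y = x \<bullet> (v * y)" for x y :: "real^'n"
  by (simp add: inner_vec_sum algebra_simps)

lemma component_le_inner:
  fixes x y :: "real^'n"
  assumes "\<And>i. 0 \<le> x $ i" "\<And>i. 0 \<le> y $ i"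
  shows "x $ i * y $ i \<le> x \<bullet> y"
  unfolding inner_vec_sum using assms by (intro member_le_sum) auto

lemma pos_subgroupD:
  assumes "pos_subgroup V"
  shows "v \<in> V \<Longrightarrow> 0 < v $ i" "1 \<in> V" "v \<in> V \<Longrightarrow> w \<in> V \<Longrightarrow> v * w \<in> V" "v \<in> V \<Longrightarrow> vinv v \<in> V"
  using assms by (auto simp: pos_subgroup_def pos_orthant_def vinv_def)

lemma transversal_subset: "transversal V T \<Longrightarrow> T' \<subseteq> T \<Longrightarrow> transversal V T'"
  by (auto simp: transversal_def)

lemma simplicial_coneI:
  "x = (\<Sum>s\<in>T. u s *\<^sub>R s) \<Longrightarrow> (\<And>s. s \<in> T \<Longrightarrow> u s > 0) \<Longrightarrow> x \<in> simplicial_cone T"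
  by (auto simp: simplicial_cone_def)

lemma convex_simplicial_cone: "convex (simplicial_cone T)"
proof (rule convexI)
  fix x y :: 'a and a b :: real
  assume "x \<in> simplicial_cone T" "y \<in> simplicial_cone T" and ab: "0 \<le> a" "0 \<le> b" "a + b = 1"
  then obtain u w where u: "x = (\<Sum>s\<in>T. u s *\<^sub>R s)" "\<forall>s\<in>T. u s > 0"
    and w: "y = (\<Sum>s\<in>T. w s *\<^sub>R s)" "\<forall>s\<in>T. w s > 0"
    by (auto simp: simplicial_cone_def)
  have "a *\<^sub>R x + b *\<^sub>R y = (\<Sum>s\<in>T. (a * u s + b * w s) *\<^sub>R s)"
    by (simp add: u(1) w(1) scaleR_sum_right sum.distrib scaleR_add_left)
  moreover have "a * u s + b * w s > 0" if "s \<in> T" for s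
  proof (cases "a = 0")
    case True then show ?thesis using ab w that by simp
  next
    case False then show ?thesis using ab u w that
      by (intro add_pos_nonneg mult_pos_pos mult_nonneg_nonneg) (auto intro: less_imp_le)
  qed
  ultimately show "a *\<^sub>R x + b *\<^sub>R y \<in> simplicial_cone T"
    by (rule simplicial_coneI)
qed

lemma simplicial_cone_linear_image:
  assumes "linear f" "inj f"
  shows "f x \<in> simplicial_cone (f ` T) \<longleftrightarrow> x \<in> simplicial_cone T"
proof -
  have sum_eq: "(\<Sum>s\<in>f ` T. u s *\<^sub>R s) = f (\<Sum>s\<in>T. u (f s) *\<^sub>R s)" for u
    using assms by (subst sum.reindex) (auto intro: inj_on_subset simp: linear_sum linear_scale)
  show ?thesis
  proof
    assume "f x \<in> simplicial_cone (f ` T)"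
    then obtain u where "f x = (\<Sum>s\<in>f ` T. u s *\<^sub>R s)" "\<forall>s\<in>f ` T. u s > 0"
      by (auto simp: simplicial_cone_def)
    then have "x = (\<Sum>s\<in>T. u (f s) *\<^sub>R s)" "\<forall>s\<in>T. u (f s) > 0"
      using assms(2) by (auto simp: sum_eq inj_eq)
    then show "x \<in> simplicial_cone T"
      by (intro simplicial_coneI[of x "\<lambda>s. u (f s)"]) auto
  next
    assume "x \<in> simplicial_cone T"
    then obtain u where u: "x = (\<Sum>s\<in>T. u s *\<^sub>R s)" "\<forall>s\<in>T. u s > 0"
      by (auto simp: simplicial_cone_def)
    define w where "w = (\<lambda>s. u (inv f s))"
    have "f x = (\<Sum>s\<in>f ` T. w s *\<^sub>R s)" "\<forall>s\<in>f ` T. w s > 0"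
      using u assms(2) by (auto simp: sum_eq w_def)
    then show "f x \<in> simplicial_cone (f ` T)"
      by (intro simplicial_coneI[of _ w]) auto
  qed
qed

lemma open_cone_eq_simplicial_cone:
  assumes "inj f"
  shows "open_cone f = simplicial_cone (range f)"
proof -
  have sum_eq: "(\<Sum>s\<in>range f. u s *\<^sub>R s) = (\<Sum>i\<in>UNIV. u (f i) *\<^sub>R f i)" for u
    using assms by (subst sum.reindex) auto
  show ?thesis
  proof (intro equalityI subsetI)
    fix x assume "x \<in> open_cone f"
    then obtain t where t: "x = (\<Sum>i\<in>UNIV. t i *\<^sub>R f i)" "\<forall>i. t i > 0"
      by (auto simp: open_cone_def)
    define w where "w = (\<lambda>s. t (inv f s))"
    have "x = (\<Sum>s\<in>range f. w s *\<^sub>R s)" "\<forall>s\<in>range f. w s > 0"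
      using t assms by (auto simp: sum_eq w_def)
    then show "x \<in> simplicial_cone (range f)"
      by (intro simplicial_coneI[of _ w]) auto
  next
    fix x assume "x \<in> simplicial_cone (range f)"
    then obtain u where "x = (\<Sum>s\<in>range f. u s *\<^sub>R s)" "\<forall>s\<in>range f. u s > 0"
      by (auto simp: simplicial_cone_def)
    then show "x \<in> open_cone f"
      unfolding open_cone_def sum_eq by (intro CollectI exI[of _ "\<lambda>i. u (f i)"]) auto
  qed
qed

text \<open>An indicator takes only the values 0 and 1, so it tends to 1 exactly when it is
  eventually 1; the threshold 1/2 extracts this from the limit.\<close>

lemma shifted_cone_eq_shifted_simplicial_cone:
  assumes "inj f"
  shows "shifted_cone l f = shifted_simplicial_cone l (range f)"
proof -
  have "((\<lambda>t. indicator (open_cone f) (x + t *\<^sub>R axis l 1)) \<longlongrightarrow> (1::real)) (at_right 0)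
     \<longleftrightarrow> (\<forall>\<^sub>F t in at_right 0. x + t *\<^sub>R axis l 1 \<in> open_cone f)" for x
  proof
    assume "((\<lambda>t. indicator (open_cone f) (x + t *\<^sub>R axis l 1)) \<longlongrightarrow> (1::real)) (at_right 0)"
    from order_tendstoD(1)[OF this, of "1/2"]
    show "\<forall>\<^sub>F t in at_right 0. x + t *\<^sub>R axis l 1 \<in> open_cone f"
      by (auto elim!: eventually_mono simp: indicator_def of_bool_def split: if_splits)
  next
    assume "\<forall>\<^sub>F t in at_right 0. x + t *\<^sub>R axis l 1 \<in> open_cone f"
    then show "((\<lambda>t. indicator (open_cone f) (x + t *\<^sub>R axis l 1)) \<longlongrightarrow> (1::real)) (at_right 0)"
      by (intro tendsto_eventually) (auto elim!: eventually_mono)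
  qed
  then show ?thesis
    unfolding shifted_cone_def shifted_simplicial_cone_def
      open_cone_eq_simplicial_cone[OF assms] eventually_at_right_field by auto
qed

text \<open>The shift direction \<open>axis l 1\<close> is an eigenvector of multiplication by
  \<open>v\<close> with eigenvalue \<open>v $ l > 0\<close>. A ray in this direction is thus sent to
  another one, with its parameter rescaled.\<close>

lemma shifted_simplicial_cone_mult:
  fixes v :: "real^'n"
  assumes v: "\<And>i. 0 < v $ i"
  shows "v * x \<in> shifted_simplicial_cone l ((*) v ` T) \<longleftrightarrow> x \<in> shifted_simplicial_cone l T"
proof -
  have inj: "inj ((*) v)"
    using v by (intro injI) (auto simp: vec_eq_iff less_imp_neq[symmetric])
  have axis: "v * axis l 1 = (v $ l) *\<^sub>R axis l 1"
    by (simp add: vec_eq_iff axis_def)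
  have *: "v * x + t *\<^sub>R axis l 1 \<in> simplicial_cone ((*) v ` T) \<longleftrightarrow>
        x + (t / v $ l) *\<^sub>R axis l 1 \<in> simplicial_cone T" for t
  proof -
    have "v * x + t *\<^sub>R axis l 1 = v * (x + (t / v $ l) *\<^sub>R axis l 1)"
      using v[of l] by (simp add: distrib_left axis)
    then show ?thesis
      using simplicial_cone_linear_image[OF linear_mult_left_vec inj, of "x + (t / v $ l) *\<^sub>R axis l 1" T]
      by simp
  qed
  show ?thesis
  proof
    assume "v * x \<in> shifted_simplicial_cone l ((*) v ` T)"
    then obtain d where d: "d > 0" "\<And>t. 0 < t \<Longrightarrow> t < d \<Longrightarrow> x + (t / v $ l) *\<^sub>R axis l 1 \<in> simplicial_cone T"
      by (auto simp: shifted_simplicial_cone_def *)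
    have "x + t *\<^sub>R axis l 1 \<in> simplicial_cone T" if "0 < t" "t < d / v $ l" for t
      using d(2)[of "t * v $ l"] that v[of l] by (simp add: field_simps)
    then show "x \<in> shifted_simplicial_cone l T"
      unfolding shifted_simplicial_cone_def
      using d(1) v[of l] by (intro CollectI exI[of _ "d / v $ l"]) auto
  next
    assume "x \<in> shifted_simplicial_cone l T"
    then obtain d where d: "d > 0" "\<And>t. 0 < t \<Longrightarrow> t < d \<Longrightarrow> x + t *\<^sub>R axis l 1 \<in> simplicial_cone T"
      by (auto simp: shifted_simplicial_cone_def)
    have "v * x + t *\<^sub>R axis l 1 \<in> simplicial_cone ((*) v ` T)" if "0 < t" "t < d * v $ l" for t
      unfolding * using d(2)[of "t / v $ l"] that v[of l] by (simp add: field_simps)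
    then show "v * x \<in> shifted_simplicial_cone l ((*) v ` T)"
      unfolding shifted_simplicial_cone_def
      using d(1) v[of l] by (intro CollectI exI[of _ "d * v $ l"]) auto
  qed
qed

section \<open>The fan of a set of orbits in general position\<close>

text \<open>The interface between the choice of representatives and the fan. Discreteness of
  \<open>V\<close> enters through \<open>finite_bounded_V\<close>; \<open>generic_affine\<close> and
  \<open>generic_axis\<close> come from perturbation, \<open>dual_pos\<close> and
  \<open>active_transversal\<close> from density of the orbits near the norm-one surface.\<close>

locale generic_orbits =
  fixes V :: "(real^'n) set" and l :: 'n and G :: "(real^'n) set"
  assumes V: "pos_subgroup V"
    and finite_bounded_V: "\<And>C. finite {v\<in>V. \<forall>i. v $ i \<le> C}"
    and finite_G: "finite G"
    and G_pos: "G \<subseteq> pos_orthant"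
    and generic_affine: "\<And>T. finite T \<Longrightarrow> T \<subseteq> orbits V G \<Longrightarrow> transversal V T \<Longrightarrow>
           card T \<le> Suc (CARD('n)) \<Longrightarrow> \<not> affine_dependent T"
    and generic_axis: "\<And>T. finite T \<Longrightarrow> T \<subseteq> orbits V G \<Longrightarrow> transversal V T \<Longrightarrow>
           card T < CARD('n) \<Longrightarrow> axis l 1 \<notin> span T"
    and one_dual: "1 \<in> dual_poly (orbits V G)"
    and dual_pos: "\<And>h i. h \<in> dual_poly (orbits V G) \<Longrightarrow> 0 < h $ i"
    and active_transversal: "\<And>h. h \<in> dual_poly (orbits V G) \<Longrightarrow>
           transversal V (active (orbits V G) h)"
begin

abbreviation S where "S \<equiv> orbits V G"
abbreviation P where "P \<equiv> dual_poly S"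
abbreviation "e \<equiv> axis l 1 :: real^'n"

section \<open>Local finiteness of \<open>S\<close> and independence of its active sets\<close>

lemmas V_simps = pos_subgroupD[OF V]

lemma S_pos: "s \<in> S \<Longrightarrow> 0 < s $ i"
  using V_simps(1) G_pos by (auto simp: orbits_def pos_orthant_def)

lemma V_mult_S:
  assumes "v \<in> V" "s \<in> S" shows "v * s \<in> S"
proof -
  obtain w g where "s = w * g" "w \<in> V" "g \<in> G" using assms by (auto simp: orbits_def)
  then have "v * s = (v * w) * g" "v * w \<in> V" using assms V_simps(3) by (auto simp: mult.assoc)
  then show ?thesis using \<open>g \<in> G\<close> unfolding orbits_def by blast
qed

lemma finite_bounded_S: "finite {s\<in>S. \<forall>i. s $ i \<le> C}"
proof -
  \<comment> \<open>The sum serves as a common upper bound for its nonnegative terms, in place of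
    their maximum.\<close>
  define D where "D g = (\<Sum>i\<in>UNIV. \<bar>C\<bar> / g $ i)" for g :: "real^'n"
  have "{s\<in>S. \<forall>i. s $ i \<le> C} \<subseteq> (\<Union>g\<in>G. (\<lambda>v. v * g) ` {v\<in>V. \<forall>i. v $ i \<le> D g})"
  proof clarify
    fix s assume s: "s \<in> S" "\<forall>i. s $ i \<le> C"
    then obtain v g where vg: "s = v * g" "v \<in> V" "g \<in> G" by (auto simp: orbits_def)
    have g: "0 < g $ i" for i using vg G_pos by (auto simp: pos_orthant_def)
    have "v $ i \<le> D g" for i
    proof -
      have "v $ i * g $ i \<le> \<bar>C\<bar>" using s vg by (metis abs_ge_self order_trans vector_mult_component)
      then have "v $ i \<le> \<bar>C\<bar> / g $ i" using g[of i] by (simp add: field_simps)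
      also have "\<dots> \<le> D g" unfolding D_def
        using g by (intro member_le_sum) (auto intro: divide_nonneg_pos)
      finally show ?thesis .
    qed
    then show "s \<in> (\<Union>g\<in>G. (\<lambda>v. v * g) ` {v\<in>V. \<forall>i. v $ i \<le> D g})" using vg by auto
  qed
  then show ?thesis
    using finite_G finite_bounded_V by (meson finite_UN_I finite_imageI finite_subset)
qed

text \<open>Closedness is clear; for boundedness, \<open>dual_pos\<close> supplies the missing lower
  bound 0 on the coordinates.\<close>

lemma compact_bounded_dual: "compact {h\<in>P. \<forall>i. h $ i \<le> M}"
proof -
  have "{h\<in>P. \<forall>i. h $ i \<le> M} = (\<Inter>s\<in>S. {h. 1 \<le> h \<bullet> s}) \<inter> (\<Inter>i. {h. h $ i \<le> M})"
    by (auto simp: dual_poly_def)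
  moreover have "closed \<dots>"
    by (intro closed_Int closed_INT ballI closed_Collect_le continuous_intros)
  moreover have "bounded {h\<in>P. \<forall>i. h $ i \<le> M}"
  proof (rule boundedI)
    fix h assume h: "h \<in> {h\<in>P. \<forall>i. h $ i \<le> M}"
    have "norm h \<le> (\<Sum>i\<in>UNIV. \<bar>h $ i\<bar>)" by (rule norm_le_l1_cart)
    also have "\<dots> \<le> (\<Sum>i\<in>(UNIV::'n set). M)"
      using h dual_pos by (intro sum_mono) (auto simp: abs_of_pos)
    finally show "norm h \<le> (\<Sum>i\<in>(UNIV::'n set). M)" .
  qed
  ultimately show ?thesis by (simp add: compact_eq_bounded_closed)
qed

text \<open>Each coordinate is positive on a compact set, hence attains a positive minimum there.
  Combined with \<open>active_bounded\<close> and \<open>finite_bounded_S\<close>, this puts the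
  active sets of all these \<open>h\<close> into one finite set.\<close>

lemma dual_lower_bound: "\<exists>m>0. \<forall>h\<in>P. (\<forall>i. h $ i \<le> M) \<longrightarrow> (\<forall>i. m \<le> h $ i)"
proof -
  let ?K = "{h\<in>P. \<forall>i. h $ i \<le> M}"
  have "\<exists>m>0. \<forall>h\<in>?K. m \<le> h $ i" for i
  proof (cases "?K = {}")
    case True then show ?thesis by (intro exI[of _ 1]) auto
  next
    case False
    have "continuous_on ?K (\<lambda>h. h $ i)" by (intro continuous_intros)
    then obtain h where "h \<in> ?K" "\<forall>h'\<in>?K. h $ i \<le> h' $ i"
      using continuous_attains_inf[OF compact_bounded_dual False] by blast
    then show ?thesis using dual_pos by blast
  qed
  then have "\<exists>m. \<forall>i. m i > 0 \<and> (\<forall>h\<in>?K. m i \<le> h $ i)" by (intro choice allI)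
  then obtain m where m: "\<And>i. m i > 0" "\<And>i h. h \<in> ?K \<Longrightarrow> m i \<le> h $ i" by auto
  show ?thesis
  proof (intro exI[of _ "Min (range m)"] conjI ballI impI allI)
    show "0 < Min (range m)" using m(1) by (subst Min_gr_iff) auto
    fix h i assume "h \<in> P" "\<forall>i. h $ i \<le> M"
    then have "m i \<le> h $ i" using m(2) by auto
    then show "Min (range m) \<le> h $ i" by (intro order_trans[OF Min_le]) auto
  qed
qed

lemma active_bounded:
  assumes "0 < m" "\<And>i. m \<le> h $ i"
  shows "active S h \<subseteq> {s\<in>S. \<forall>i. s $ i \<le> 1 / m}"
proof (intro subsetI CollectI conjI allI)
  fix s i assume "s \<in> active S h"
  then have s: "s \<in> S" "h \<bullet> s = 1" by (auto simp: active_def)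
  then show "s \<in> S" by simp
  have "m * s $ i \<le> h $ i * s $ i" using assms(2) S_pos[OF s(1)] by (intro mult_right_mono) (auto intro: less_imp_le)
  also have "\<dots> \<le> h \<bullet> s"
    using S_pos[OF s(1)] assms by (intro component_le_inner) (auto intro: less_imp_le order_trans)
  finally show "s $ i \<le> 1 / m" using assms(1) s by (simp add: field_simps)
qed

lemma finite_active: assumes "h \<in> P" shows "finite (active S h)"
proof -
  have "0 < Min (range (($) h))" using dual_pos[OF assms] by (subst Min_gr_iff) auto
  then show ?thesis
    using active_bounded[of "Min (range (($) h))" h] finite_bounded_S by (auto intro: finite_subset)
qed

text \<open>The active points lie on the affine hyperplane \<open>h \<bullet> x = 1\<close> of
  dimension n - 1, which has no room for n + 1 affinely independent points. Applying
  \<open>h\<close> to a linear relation between active points shows that its coefficients sum to 0,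
  so it would be an affine relation.\<close>

lemma active_independent:
  assumes "h \<in> P"
  shows "card (active S h) \<le> CARD('n)" "independent (active S h)"
proof -
  have plane: "active S h \<subseteq> {x. h \<bullet> x = 1}" by (auto simp: active_def)
  have indep: "\<not> affine_dependent T" if "T \<subseteq> active S h" "card T \<le> Suc CARD('n)" for T
    using that finite_active[OF assms] transversal_subset[OF active_transversal[OF assms]]
    by (intro generic_affine) (auto simp: active_def intro: finite_subset)
  have "h \<noteq> 0" using dual_pos[OF assms] by fastforce
  then have dim: "aff_dim {x. h \<bullet> x = 1} = int CARD('n) - 1" by simp
  show card: "card (active S h) \<le> CARD('n)"
  proof (rule ccontr)
    assume "\<not> ?thesis"
    then obtain T where T: "T \<subseteq> active S h" "card T = Suc CARD('n)"
      by (metis not_less_eq_eq obtain_subset_with_card_n)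
    have "aff_dim T = int (card T) - 1"
      using aff_dim_affine_independent[OF indep[of T]] T by simp
    moreover have "aff_dim T \<le> int CARD('n) - 1"
      using aff_dim_subset[of T "{x. h \<bullet> x = 1}"] T plane dim by auto
    ultimately show False using T by simp
  qed
  show "independent (active S h)"
  proof
    assume "dependent (active S h)"
    then obtain u where u: "\<exists>s\<in>active S h. u s \<noteq> 0" "(\<Sum>s\<in>active S h. u s *\<^sub>R s) = 0"
      using finite_active[OF assms] dependent_finite by blast
    have "(\<Sum>s\<in>active S h. u s) = (\<Sum>s\<in>active S h. u s * (h \<bullet> s))"
      by (intro sum.cong) (auto simp: active_def)
    also have "\<dots> = h \<bullet> (\<Sum>s\<in>active S h. u s *\<^sub>R s)" by (simp add: inner_sum_right)
    finally have "(\<Sum>s\<in>active S h. u s) = 0" using u by simp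
    then have "affine_dependent (active S h)"
      using u finite_active[OF assms] affine_dependent_explicit_finite by blast
    then show False using indep[of "active S h"] card by simp
  qed
qed

section \<open>Functionals minimizing the value at a point\<close>

definition minimal_at :: "real^'n \<Rightarrow> real^'n \<Rightarrow> bool" where
  "minimal_at x h \<longleftrightarrow> h \<in> P \<and> (\<forall>h'\<in>P. h \<bullet> x \<le> h' \<bullet> x)"

lemma minimal_at_bound:
  assumes "h \<in> P" "h \<bullet> x \<le> C" "0 < c" "\<And>i. c \<le> x $ i"
  shows "h $ i \<le> C / c"
proof -
  have "h $ i * c \<le> h $ i * x $ i" using assms dual_pos[OF assms(1), of i] by (intro mult_left_mono) auto
  also have "\<dots> \<le> h \<bullet> x"
    using assms dual_pos[OF assms(1)] by (intro component_le_inner) (auto intro: less_imp_le order_trans)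
  finally show ?thesis using assms by (simp add: field_simps)
qed

lemma pos_orthant_lower_bound:
  assumes "x \<in> pos_orthant" obtains c where "0 < c" "\<And>i. c \<le> (x::real^'n) $ i"
proof
  show "0 < Min (range (($) x))" using assms by (subst Min_gr_iff) (auto simp: pos_orthant_def)
  show "Min (range (($) x)) \<le> x $ i" for i by auto
qed

text \<open>The functional 1 belongs to \<open>P\<close>, and by \<open>minimal_at_bound\<close> all
  functionals doing at least as well at \<open>x\<close> lie in a compact box. A minimizer in the
  box is therefore a global one.\<close>

lemma ex_minimal_at:
  assumes x: "x \<in> pos_orthant"
  shows "\<exists>h. minimal_at x h"
proof -
  obtain c where c: "0 < c" "\<And>i. c \<le> x $ i"
    using pos_orthant_lower_bound[OF x] by blast
  let ?K = "{h\<in>P. \<forall>i. h $ i \<le> 1 \<bullet> x / c}"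
  have inK: "h \<in> ?K" if "h \<in> P" "h \<bullet> x \<le> 1 \<bullet> x" for h
    using minimal_at_bound[OF that c] that by auto
  have ne: "?K \<noteq> {}" using inK[OF one_dual] by auto
  have "continuous_on ?K (\<lambda>h. h \<bullet> x)" by (intro continuous_intros)
  then obtain h where h: "h \<in> ?K" "\<forall>h'\<in>?K. h \<bullet> x \<le> h' \<bullet> x"
    using continuous_attains_inf[OF compact_bounded_dual ne] by blast
  have "h \<bullet> x \<le> h' \<bullet> x" if "h' \<in> P" for h'
  proof (cases "h' \<bullet> x \<le> 1 \<bullet> x")
    case True then show ?thesis using h inK that by auto
  next
    case False
    then show ?thesis using h(2) inK[OF one_dual] by fastforce
  qed
  then show ?thesis using h by (auto simp: minimal_at_def)
qed

text \<open>If the normalized point were outside the hull, a separating functional, corrected by a multiple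
  of \<open>h\<close>, would be a direction in which \<open>h\<close> can be moved inside \<open>P\<close> while decreasing its value at \<open>x\<close>.\<close>

lemma minimal_at_in_hull:
  assumes x: "x \<in> pos_orthant" and h: "minimal_at x h"
  shows "(1 / (h \<bullet> x)) *\<^sub>R x \<in> convex hull (active S h)"
proof (rule ccontr)
  let ?y = "(1 / (h \<bullet> x)) *\<^sub>R x"
  have hP: "h \<in> P" using h by (simp add: minimal_at_def)
  have "0 < h \<bullet> x"
    unfolding inner_vec_sum using x dual_pos[OF hP] by (intro sum_pos) (auto simp: pos_orthant_def)
  then have hy: "h \<bullet> ?y = 1" by simp
  assume "?y \<notin> convex hull (active S h)"
  moreover have "closed (convex hull (active S h))"
    using finite_active[OF hP] by (simp add: compact_imp_closed finite_imp_compact_convex_hull)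
  ultimately obtain a b where ab: "a \<bullet> ?y < b" "\<forall>z\<in>convex hull (active S h). b < a \<bullet> z"
    using separating_hyperplane_closed_point[of "convex hull (active S h)" ?y] by auto
  \<comment> \<open>Since \<open>h\<close> equals 1 at the normalized point and at every active
    point, subtracting \<open>b *\<^sub>R h\<close> moves the separating level from \<open>b\<close>
    to 0.\<close>
  define d where "d = a - b *\<^sub>R h"
  have dy: "d \<bullet> ?y < 0"
    using ab hy by (simp only: d_def inner_diff_left inner_scaleR_left)
  have dx: "d \<bullet> x < 0" using dy \<open>0 < h \<bullet> x\<close> by (simp add: field_simps)
  have ds: "0 < d \<bullet> s" if "s \<in> active S h" for s
  proof -
    have "b < a \<bullet> s" using bspec[OF ab(2) hull_inc[OF that]] .
    moreover have "h \<bullet> s = 1" using that by (simp add: active_def)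
    ultimately show ?thesis by (simp add: d_def inner_diff_left)
  qed
  \<comment> \<open>Only the finitely many points of \<open>F\<close> need a limit argument. Every
    other point has \<open>h \<bullet> s \<ge> 2\<close>, so it stays feasible as long as
    \<open>h + t *\<^sub>R d\<close> is coordinatewise at least \<open>h / 2\<close>.\<close>
  define F where "F = {s\<in>S. h \<bullet> s < 2}"
  obtain m where m: "0 < m" "\<And>i. m \<le> h $ i"
    using pos_orthant_lower_bound[of h] dual_pos[OF hP] by (auto simp: pos_orthant_def)
  have "F \<subseteq> {s\<in>S. \<forall>i. s $ i \<le> 2 / m}"
  proof (intro subsetI CollectI conjI allI)
    fix s i assume "s \<in> F"
    then have s: "s \<in> S" "h \<bullet> s < 2" by (auto simp: F_def)
    then show "s \<in> S" by simp
    have "m * s $ i \<le> h $ i * s $ i" using m(2) S_pos[OF s(1)] by (intro mult_right_mono) (auto intro: less_imp_le)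
    also have "\<dots> \<le> h \<bullet> s"
      using S_pos[OF s(1)] dual_pos[OF hP] by (intro component_le_inner) (auto intro: less_imp_le)
    finally show "s $ i \<le> 2 / m" using m(1) s by (simp add: field_simps)
  qed
  then have finF: "finite F" using finite_bounded_S finite_subset by blast
  have lim: "((\<lambda>t. (h + t *\<^sub>R d) \<bullet> s) \<longlongrightarrow> h \<bullet> s) (at_right 0)" for s
  proof -
    have "((\<lambda>t. (h + t *\<^sub>R d) \<bullet> s) \<longlongrightarrow> (h + 0 *\<^sub>R d) \<bullet> s) (at_right 0)" by (intro tendsto_intros)
    then show ?thesis by simp
  qed
  have evF: "\<forall>\<^sub>F t in at_right 0. \<forall>s\<in>F. 1 \<le> (h + t *\<^sub>R d) \<bullet> s"
  proof (rule eventually_ball_finite[OF finF], intro ballI)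
    fix s assume s: "s \<in> F"
    show "\<forall>\<^sub>F t in at_right 0. 1 \<le> (h + t *\<^sub>R d) \<bullet> s"
    proof (cases "s \<in> active S h")
      case True
      show ?thesis using eventually_at_right_less[of "0::real"]
        by eventually_elim
          (use True ds[OF True] in \<open>simp add: active_def inner_add_left less_imp_le\<close>)
    next
      case False
      then have "1 < h \<bullet> s" using s hP by (auto simp: F_def active_def dual_poly_def less_le)
      then show ?thesis
        by (rule eventually_mono[OF order_tendstoD(1)[OF lim]]) simp
    qed
  qed
  have evi: "\<forall>\<^sub>F t in at_right 0. \<forall>i. h $ i / 2 \<le> (h + t *\<^sub>R d) $ i"
  proof (rule eventually_all_finite)
    fix i
    have "((\<lambda>t. (h + t *\<^sub>R d) $ i) \<longlongrightarrow> (h + 0 *\<^sub>R d) $ i) (at_right 0)" by (intro tendsto_intros)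
    then have "\<forall>\<^sub>F t in at_right 0. h $ i / 2 < (h + t *\<^sub>R d) $ i"
      using dual_pos[OF hP, of i] by (intro order_tendstoD(1)) auto
    then show "\<forall>\<^sub>F t in at_right 0. h $ i / 2 \<le> (h + t *\<^sub>R d) $ i" by (auto elim: eventually_mono)
  qed
  obtain t where t: "0 < t" "\<forall>s\<in>F. 1 \<le> (h + t *\<^sub>R d) \<bullet> s" "\<forall>i. h $ i / 2 \<le> (h + t *\<^sub>R d) $ i"
    using eventually_happens'[OF _ eventually_conj[OF eventually_at_right_less[of "0::real"] eventually_conj[OF evF evi]]]
    by auto
  have "1 \<le> (h + t *\<^sub>R d) \<bullet> s" if "s \<in> S" for s
  proof (cases "s \<in> F")
    case True then show ?thesis using t by blast
  next
    case False
    then have "2 \<le> h \<bullet> s" using that by (auto simp: F_def)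
    then have "1 \<le> (\<Sum>i\<in>UNIV. (h $ i / 2) * s $ i)"
      by (simp add: inner_vec_sum sum_divide_distrib[symmetric])
    also have "\<dots> \<le> (h + t *\<^sub>R d) \<bullet> s"
      unfolding inner_vec_sum using t(3) S_pos[OF that]
      by (intro sum_mono mult_right_mono) (auto intro: less_imp_le)
    finally show ?thesis .
  qed
  then have "h + t *\<^sub>R d \<in> P" by (auto simp: dual_poly_def)
  then have "h \<bullet> x \<le> (h + t *\<^sub>R d) \<bullet> x" using h by (auto simp: minimal_at_def)
  then show False using t(1) dx by (simp add: inner_add_left mult_less_0_iff zero_le_mult_iff)
qed

section \<open>Full-dimensional cells: disjointness and covering\<close>

definition cells :: "(real^'n) set set" where
  "cells = {active S h | h. h \<in> P \<and> card (active S h) = CARD('n)}"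

text \<open>Write \<open>x\<close> as a nonnegative combination of active points and let
  \<open>T\<close> be those with positive coefficient. Then \<open>x\<close> lies in
  \<open>span T\<close>, so \<open>gen\<close> forces \<open>e\<close> into \<open>span T\<close>,
  and \<open>generic_axis\<close> forces \<open>T\<close> to have n elements. Since an active set
  has at most n points, \<open>T\<close> is all of it and every coefficient is positive.\<close>

lemma minimal_at_in_cell:
  assumes x: "x \<in> pos_orthant" and h: "minimal_at x h"
    and gen: "\<And>T. T \<subseteq> active S h \<Longrightarrow> e \<notin> span T \<Longrightarrow> x \<notin> span T"
  shows "active S h \<in> cells" "x \<in> simplicial_cone (active S h)"
proof -
  let ?A = "active S h"
  have hP: "h \<in> P" using h by (simp add: minimal_at_def)
  have hx: "0 < h \<bullet> x"
    unfolding inner_vec_sum using x dual_pos[OF hP] by (intro sum_pos) (auto simp: pos_orthant_def)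
  obtain u where u: "\<forall>s\<in>?A. 0 \<le> u s" "(1 / (h \<bullet> x)) *\<^sub>R x = (\<Sum>s\<in>?A. u s *\<^sub>R s)"
    using minimal_at_in_hull[OF x h] finite_active[OF hP] by (auto simp: convex_hull_finite)
  define w where "w s = (h \<bullet> x) * u s" for s
  have "x = (h \<bullet> x) *\<^sub>R ((1 / (h \<bullet> x)) *\<^sub>R x)" using hx by simp
  also have "\<dots> = (\<Sum>s\<in>?A. w s *\<^sub>R s)" unfolding u w_def by (simp add: scaleR_sum_right)
  finally have xw: "x = (\<Sum>s\<in>?A. w s *\<^sub>R s)" .
  have w: "\<forall>s\<in>?A. 0 \<le> w s" using u hx by (auto simp: w_def)
  define T where "T = {s\<in>?A. 0 < w s}"
  have TA: "T \<subseteq> ?A" by (auto simp: T_def)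
  have "x = (\<Sum>s\<in>T. w s *\<^sub>R s)"
    unfolding xw using w finite_active[OF hP]
    by (intro sum.mono_neutral_right) (auto simp: T_def less_le)
  then have "x \<in> span T" by (auto intro: span_sum span_scale span_base)
  then have "e \<in> span T" using gen TA by blast
  then have "\<not> card T < CARD('n)"
    using generic_axis[of T] TA finite_active[OF hP] transversal_subset[OF active_transversal[OF hP] TA]
    by (auto simp: active_def intro: finite_subset)
  then have T: "T = ?A" "card ?A = CARD('n)"
    using card_mono[OF finite_active[OF hP] TA] active_independent(1)[OF hP]
      card_subset_eq[OF finite_active[OF hP] TA] by auto
  show "?A \<in> cells" using hP T by (auto simp: cells_def)
  have "\<forall>s\<in>?A. 0 < w s" using T(1) by (auto simp: T_def)
  then show "x \<in> simplicial_cone ?A" using xw by (intro simplicial_coneI[of x w]) auto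
qed

text \<open>If \<open>h\<close>, \<open>h'\<close> support two cells containing \<open>x\<close>, then expanding \<open>x\<close> in the first cell gives
  \<open>h \<bullet> x \<le> h' \<bullet> x\<close>, with equality only if \<open>h'\<close> is also active on the whole first cell.\<close>

lemma cells_disjoint:
  assumes "T \<in> cells" "T' \<in> cells" "x \<in> simplicial_cone T" "x \<in> simplicial_cone T'"
  shows "T = T'"
proof -
  have key: "h \<bullet> x \<le> h' \<bullet> x \<and> (h' \<bullet> x \<le> h \<bullet> x \<longrightarrow> active S h \<subseteq> active S h')"
    if h: "h \<in> P" "h' \<in> P" "x \<in> simplicial_cone (active S h)" for h h'
  proof -
    obtain u where u: "x = (\<Sum>s\<in>active S h. u s *\<^sub>R s)" "\<forall>s\<in>active S h. u s > 0"
      using h by (auto simp: simplicial_cone_def)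
    have hx: "h \<bullet> x = (\<Sum>s\<in>active S h. u s)"
      unfolding u(1) by (simp add: inner_sum_right, intro sum.cong) (auto simp: active_def)
    have h'x: "h' \<bullet> x = (\<Sum>s\<in>active S h. u s * (h' \<bullet> s))"
      unfolding u(1) by (simp add: inner_sum_right)
    have h's: "1 \<le> h' \<bullet> s" if "s \<in> active S h" for s
      using h that by (auto simp: dual_poly_def active_def)
    have le: "u s \<le> u s * (h' \<bullet> s)" if "s \<in> active S h" for s
      using mult_left_mono[OF h's[OF that], of "u s"] u(2) that by (simp add: less_imp_le)
    show ?thesis
    proof (intro conjI impI subsetI)
      show "h \<bullet> x \<le> h' \<bullet> x" unfolding hx h'x using le by (rule sum_mono)
      fix s assume "h' \<bullet> x \<le> h \<bullet> x" and s: "s \<in> active S h"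
      then have eq: "(\<Sum>s\<in>active S h. u s) = (\<Sum>s\<in>active S h. u s * (h' \<bullet> s))"
        using hx h'x sum_mono[of "active S h" u "\<lambda>s. u s * (h' \<bullet> s)"] le by simp
      have "u s = u s * (h' \<bullet> s)"
        using sum_mono_inv[OF eq le s] finite_active[OF h(1)] by simp
      then show "s \<in> active S h'" using u(2) s by (auto simp: active_def)
    qed
  qed
  obtain h h' where hh: "T = active S h" "h \<in> P" "T' = active S h'" "h' \<in> P"
    using assms by (auto simp: cells_def)
  then show ?thesis using key[of h h'] key[of h' h] assms by auto
qed

text \<open>For t in [0, 1] the minimal value is at most that of the functional 1, hence at most
  \<open>1 \<bullet> x + 1\<close>. This bounds \<open>h\<close> from above, then from below by
  \<open>dual_lower_bound\<close>, and so bounds the active points independently of t.\<close>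

lemma finite_active_near:
  assumes x: "x \<in> pos_orthant"
  shows "\<exists>F. finite F \<and> F \<subseteq> S \<and>
    (\<forall>t h. 0 \<le> t \<longrightarrow> t \<le> 1 \<longrightarrow> minimal_at (x + t *\<^sub>R e) h \<longrightarrow> active S h \<subseteq> F)"
proof -
  obtain c where c: "0 < c" "\<And>i. c \<le> x $ i"
    using pos_orthant_lower_bound[OF x] by blast
  let ?M = "(1 \<bullet> x + 1) / c"
  obtain m where m: "0 < m" "\<forall>h\<in>P. (\<forall>i. h $ i \<le> ?M) \<longrightarrow> (\<forall>i. m \<le> h $ i)"
    using dual_lower_bound by blast
  show ?thesis
  proof (intro exI[of _ "{s\<in>S. \<forall>i. s $ i \<le> 1 / m}"] conjI allI impI)
    fix t h assume t: "0 \<le> t" "t \<le> 1" and h: "minimal_at (x + t *\<^sub>R e) h"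
    have hP: "h \<in> P" using h by (simp add: minimal_at_def)
    have "h \<bullet> (x + t *\<^sub>R e) \<le> 1 \<bullet> (x + t *\<^sub>R e)" using h one_dual by (auto simp: minimal_at_def)
    also have "\<dots> \<le> 1 \<bullet> x + 1" using t by (simp add: inner_add_right inner_axis)
    finally have le: "h \<bullet> (x + t *\<^sub>R e) \<le> 1 \<bullet> x + 1" .
    have "c \<le> (x + t *\<^sub>R e) $ i" for i
      using c(2)[of i] t by (cases "i = l") (auto simp: axis_def)
    then have "h $ i \<le> ?M" for i using minimal_at_bound[OF hP le c(1)] by blast
    then show "active S h \<subseteq> {s\<in>S. \<forall>i. s $ i \<le> 1 / m}"
      using active_bounded[of m h] m hP by blast
  qed (use finite_bounded_S in auto)
qed

text \<open>For small t > 0 the point \<open>x + t *\<^sub>R e\<close> avoids the spans excluded in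
  \<open>minimal_at_in_cell\<close>, hence lies in the open cone of some cell. It remains to find
  one cell that serves all small t.\<close>

lemma cells_cover:
  assumes x: "x \<in> pos_orthant"
  shows "\<exists>T\<in>cells. x \<in> shifted_simplicial_cone l T"
proof -
  obtain F where F: "finite F" "F \<subseteq> S"
    "\<And>t h. 0 \<le> t \<Longrightarrow> t \<le> 1 \<Longrightarrow> minimal_at (x + t *\<^sub>R e) h \<Longrightarrow> active S h \<subseteq> F"
    using finite_active_near[OF x] by blast
  \<comment> \<open>A subspace not containing \<open>e\<close> meets the line through
    \<open>x\<close> in direction \<open>e\<close> for at most one parameter, and \<open>F\<close>
    has finitely many subsets, so \<open>bad\<close> is finite.\<close>
  define bad where "bad = (\<Union>T\<in>{T\<in>Pow F. e \<notin> span T}. {t. x + t *\<^sub>R e \<in> span T})"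
  have "finite {t. x + t *\<^sub>R e \<in> span T}" if "e \<notin> span T" for T
  proof -
    have "t = t'" if "x + t *\<^sub>R e \<in> span T" "x + t' *\<^sub>R e \<in> span T" for t t'
    proof (rule ccontr)
      assume "t \<noteq> t'"
      have "(x + t *\<^sub>R e) - (x + t' *\<^sub>R e) \<in> span T" using that by (rule span_diff)
      then have "(t - t') *\<^sub>R e \<in> span T" by (simp add: algebra_simps)
      then have "(1 / (t - t')) *\<^sub>R ((t - t') *\<^sub>R e) \<in> span T" by (rule span_scale)
      then show False using \<open>t \<noteq> t'\<close> \<open>e \<notin> span T\<close> by simp
    qed
    then have "{t. x + t *\<^sub>R e \<in> span T} \<subseteq> {t}" if "x + t *\<^sub>R e \<in> span T" for t using that by blast
    then show ?thesis by (metis (no_types, lifting) Collect_empty_eq finite.emptyI finite.insertI finite_subset)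
  qed
  then have "finite bad" unfolding bad_def using F(1) by (intro finite_UN_I) auto
  then have "\<forall>\<^sub>F t in at 0. t \<notin> bad"
    using islimpt_finite[of bad 0] islimpt_iff_eventually[of "0::real" bad] by blast
  then have ev_bad: "\<forall>\<^sub>F t in at_right 0. t \<notin> bad" by (simp add: eventually_at_split)
  have ev1: "\<forall>\<^sub>F t in at_right 0. t \<le> (1::real)"
    by (auto simp: eventually_at_right_field intro: exI[of _ 1])
  have ev: "\<forall>\<^sub>F t in at_right 0. \<exists>T\<in>cells \<inter> Pow F. x + t *\<^sub>R e \<in> simplicial_cone T"
    using ev_bad ev1 eventually_at_right_less[of "0::real"]
  proof eventually_elim
    case (elim t)
    have xt: "x + t *\<^sub>R e \<in> pos_orthant"
      using x elim by (auto simp: pos_orthant_def axis_def intro: add_pos_nonneg)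
    obtain h where h: "minimal_at (x + t *\<^sub>R e) h" using ex_minimal_at[OF xt] by blast
    have AF: "active S h \<subseteq> F" using F(3)[OF _ _ h] elim by auto
    have "x + t *\<^sub>R e \<notin> span T" if "T \<subseteq> active S h" "e \<notin> span T" for T
      using elim(1) that AF by (auto simp: bad_def)
    from minimal_at_in_cell[OF xt h this] AF show ?case by blast
  qed
  \<comment> \<open>Pigeonhole: only finitely many cells are available, so one of them recurs for
    arbitrarily small t. Convexity of its open cone then fills the gaps between these
    parameters.\<close>
  have "\<exists>T\<in>cells \<inter> Pow F. \<exists>\<^sub>F t in at_right 0. x + t *\<^sub>R e \<in> simplicial_cone T"
  proof (rule ccontr)
    assume "\<not> ?thesis"
    then have "\<forall>T\<in>cells \<inter> Pow F. \<forall>\<^sub>F t in at_right 0. x + t *\<^sub>R e \<notin> simplicial_cone T"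
      by (simp add: not_frequently)
    then have "\<forall>\<^sub>F t in at_right 0. \<forall>T\<in>cells \<inter> Pow F. x + t *\<^sub>R e \<notin> simplicial_cone T"
      using F(1) by (intro eventually_ball_finite) auto
    with ev have "\<forall>\<^sub>F t in at_right (0::real). False"
      by eventually_elim blast
    then show False by (simp add: trivial_limit_at_right_real)
  qed
  then obtain T where T: "T \<in> cells" "\<exists>\<^sub>F t in at_right 0. x + t *\<^sub>R e \<in> simplicial_cone T" by blast
  have small: "\<exists>t. 0 < t \<and> t < d \<and> x + t *\<^sub>R e \<in> simplicial_cone T" if "0 < d" for d
    using T(2) that unfolding frequently_def eventually_at_right_field by auto
  obtain t1 where t1: "0 < t1" "x + t1 *\<^sub>R e \<in> simplicial_cone T" using small[of 1] by auto
  have "x + t *\<^sub>R e \<in> simplicial_cone T" if t: "0 < t" "t < t1" for t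
  proof -
    obtain t2 where t2: "0 < t2" "t2 < t" "x + t2 *\<^sub>R e \<in> simplicial_cone T" using small[of t] t by auto
    define a where "a = (t1 - t) / (t1 - t2)"
    have a: "0 \<le> a" "0 \<le> 1 - a" using t t2 by (auto simp: a_def field_simps)
    have "a * (t1 - t2) = t1 - t" using t t2 by (simp add: a_def)
    then have tt: "t = a * t2 + (1 - a) * t1" by (simp add: algebra_simps)
    have "a *\<^sub>R (x + t2 *\<^sub>R e) + (1 - a) *\<^sub>R (x + t1 *\<^sub>R e) \<in> simplicial_cone T"
      using convexD[OF convex_simplicial_cone t2(3) t1(2) a] by simp
    moreover have "a *\<^sub>R (x + t2 *\<^sub>R e) + (1 - a) *\<^sub>R (x + t1 *\<^sub>R e) = x + t *\<^sub>R e"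
      by (subst tt) (simp add: algebra_simps)
    ultimately show ?thesis by simp
  qed
  then show ?thesis using T(1) t1(1) by (auto simp: shifted_simplicial_cone_def)
qed

lemma cells_shifted_unique:
  assumes "T \<in> cells" "T' \<in> cells" "x \<in> shifted_simplicial_cone l T" "x \<in> shifted_simplicial_cone l T'"
  shows "T = T'"
proof -
  obtain d d' where d: "0 < d" "\<And>t. 0 < t \<Longrightarrow> t < d \<Longrightarrow> x + t *\<^sub>R e \<in> simplicial_cone T"
    and d': "0 < d'" "\<And>t. 0 < t \<Longrightarrow> t < d' \<Longrightarrow> x + t *\<^sub>R e \<in> simplicial_cone T'"
    using assms(3,4) by (auto simp: shifted_simplicial_cone_def)
  have "0 < min d d' / 2" "min d d' / 2 < d" "min d d' / 2 < d'" using d d' by auto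
  then show ?thesis using cells_disjoint[OF assms(1,2)] d(2) d'(2) by blast
qed

section \<open>The action of \<open>V\<close> on the cells\<close>

lemma cells_mult:
  assumes v: "v \<in> V" and T: "T \<in> cells"
  shows "(*) v ` T \<in> cells"
proof -
  obtain h where h: "T = active S h" "h \<in> P" "card T = CARD('n)" using T by (auto simp: cells_def)
  have nz: "v $ i \<noteq> 0" for i using V_simps(1)[OF v, of i] by simp
  have cancel: "vinv v * (v * y) = y" "v * (vinv v * y) = y" for y using vinv_mult_cancel[OF nz] by auto
  have inner: "(vinv v * h) \<bullet> s = h \<bullet> (vinv v * s)" for s by (rule inner_mult_vec)
  have vS: "vinv v * s \<in> S" if "s \<in> S" for s using V_mult_S V_simps(4) v that by blast
  \<comment> \<open>Multiplication by \<open>vinv v\<close> is self-adjoint, so moving points by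
    \<open>v\<close> moves the supporting functional by \<open>vinv v\<close>.\<close>
  have "vinv v * h \<in> P" using h(2) vS by (auto simp: dual_poly_def inner)
  moreover have "active S (vinv v * h) = (*) v ` T"
  proof (intro equalityI subsetI)
    fix s assume "s \<in> active S (vinv v * h)"
    then have "vinv v * s \<in> T" by (auto simp: h(1) active_def inner vS)
    then show "s \<in> (*) v ` T" using cancel(2)[of s] by (metis imageI)
  next
    fix s assume "s \<in> (*) v ` T"
    then show "s \<in> active S (vinv v * h)" using v
      by (auto simp: h(1) active_def inner cancel V_mult_S)
  qed
  moreover have "card ((*) v ` T) = CARD('n)"
    using h(3) by (metis cancel(1) card_image inj_onI)
  ultimately show ?thesis unfolding cells_def
    by (intro CollectI exI[of _ "vinv v * h"]) auto
qed

text \<open>If both images agree, the quotient of \<open>v\<close> by \<open>w\<close> sends a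
  vertex of \<open>T\<close> to a vertex of \<open>T\<close>. Transversality of active sets forces
  this quotient to be 1; in particular no nontrivial element permutes the vertices of a
  cell.\<close>

lemma cells_free:
  assumes "T \<in> cells" "v \<in> V" "w \<in> V" "(*) v ` T = (*) w ` T"
  shows "v = w"
proof -
  obtain h where h: "T = active S h" "h \<in> P" "card T = CARD('n)" using assms by (auto simp: cells_def)
  have nz: "v $ i \<noteq> 0" "w $ i \<noteq> 0" for i using V_simps(1)[of _ i] assms by force+
  have "T \<noteq> {}" using h(3) by auto
  then obtain s where s: "s \<in> T" by blast
  then obtain s' where s': "s' \<in> T" "v * s = w * s'" using assms(4) by (metis imageE imageI)
  then have "(vinv w * v) * s = s'" using vinv_mult_cancel(1)[of w s'] nz by (simp add: mult.assoc)
  moreover have "vinv w * v \<in> V" using V_simps assms by auto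
  ultimately have one: "vinv w * v = 1"
    using active_transversal[OF h(2)] s s' h(1) by (auto simp: transversal_def)
  have "v = w * (vinv w * v)" using vinv_mult_cancel(2)[of w v] nz by simp
  then show ?thesis using one by simp
qed

text \<open>A vertex \<open>g\<close> of a cell satisfies \<open>h \<bullet> g = 1\<close>, which
  bounds \<open>h\<close> above, hence below, hence bounds all vertices of the cell. As every orbit
  of cells meets \<open>G\<close>, this gives finiteness modulo \<open>V\<close>.\<close>

lemma finite_cells_meeting_G: "finite {T\<in>cells. T \<inter> G \<noteq> {}}"
proof -
  have "\<exists>F. finite F \<and> (\<forall>T\<in>cells. g \<in> T \<longrightarrow> T \<subseteq> F)" if g: "g \<in> G" for g
  proof -
    have "g \<in> pos_orthant" using g G_pos by auto
    then obtain c where c: "0 < c" "\<And>i. c \<le> g $ i" using pos_orthant_lower_bound by blast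
    obtain m where m: "0 < m" "\<forall>h\<in>P. (\<forall>i. h $ i \<le> 1 / c) \<longrightarrow> (\<forall>i. m \<le> h $ i)"
      using dual_lower_bound by blast
    have "T \<subseteq> {s\<in>S. \<forall>i. s $ i \<le> 1 / m}" if "T \<in> cells" "g \<in> T" for T
    proof -
      obtain h where h: "T = active S h" "h \<in> P" using \<open>T \<in> cells\<close> by (auto simp: cells_def)
      have "h \<bullet> g \<le> 1" using that h by (auto simp: active_def)
      then have "h $ i \<le> 1 / c" for i using minimal_at_bound[OF h(2) _ c] by blast
      then show ?thesis using active_bounded[of m h] m h by blast
    qed
    then show ?thesis using finite_bounded_S[of "1 / m"] by blast
  qed
  then obtain F where F: "\<And>g. g \<in> G \<Longrightarrow> finite (F g)" "\<And>g T. g \<in> G \<Longrightarrow> T \<in> cells \<Longrightarrow> g \<in> T \<Longrightarrow> T \<subseteq> F g"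
    by metis
  have "{T\<in>cells. T \<inter> G \<noteq> {}} \<subseteq> (\<Union>g\<in>G. Pow (F g))" using F(2) by blast
  then show ?thesis using F(1) finite_G by (meson finite_Pow_iff finite_UN_I finite_subset)
qed

lemma cell_orbit_meets_G:
  assumes "T \<in> cells" shows "\<exists>v\<in>V. (*) v ` T \<inter> G \<noteq> {}"
proof -
  obtain h where h: "T = active S h" "card T = CARD('n)" using assms by (auto simp: cells_def)
  have "T \<noteq> {}" using h(2) by auto
  then obtain s where s: "s \<in> T" by blast
  then obtain v g where vg: "v \<in> V" "g \<in> G" "s = v * g" using h by (auto simp: active_def orbits_def)
  have nz: "v $ i \<noteq> 0" for i using V_simps(1)[OF vg(1), of i] by simp
  have "vinv v * s = g" using vg vinv_mult_cancel(1)[of v] nz by simp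
  then have "g \<in> (*) (vinv v) ` T" using s by blast
  then show ?thesis using vg V_simps(4) by blast
qed

text \<open>The predicate \<open>Q T\<close> depends only on the orbit of \<open>T\<close>, so the
  choice \<open>r\<close> is constant on orbits and selects one cell in each. Uniqueness of the
  group element is \<open>cells_free\<close>.\<close>

lemma cell_representatives:
  "\<exists>\<R>. finite \<R> \<and> \<R> \<subseteq> cells \<and> (\<forall>T\<in>cells. \<exists>!p. p \<in> \<R> \<times> V \<and> (*) (snd p) ` T = fst p)"
proof -
  define Q where "Q T R \<longleftrightarrow> R \<in> cells \<and> R \<inter> G \<noteq> {} \<and> (\<exists>v\<in>V. (*) v ` T = R)" for T R
  define r where "r T = (SOME R. Q T R)" for T
  have r: "Q T (r T)" if T: "T \<in> cells" for T
  proof -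
    obtain v where "v \<in> V" "(*) v ` T \<inter> G \<noteq> {}" using cell_orbit_meets_G[OF T] by blast
    then have "Q T ((*) v ` T)" using cells_mult T unfolding Q_def by blast
    then show ?thesis unfolding r_def by (rule someI)
  qed
  have r_mult: "r ((*) v ` T) = r T" if v: "v \<in> V" for v T
  proof -
    have nz: "v $ i \<noteq> 0" for i using V_simps(1)[OF v, of i] by simp
    have 1: "(*) w ` (*) v ` T = (*) (w * v) ` T" for w by (auto simp: image_image mult.assoc)
    have 2: "(*) w ` T = (*) (w * vinv v) ` (*) v ` T" for w
      using vinv_mult_cancel[OF nz] by (simp add: image_image mult.assoc)
    have "Q ((*) v ` T) R = Q T R" for R
      unfolding Q_def using 1 2 V_simps(3,4) v by metis
    then show ?thesis by (simp add: r_def)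
  qed
  show ?thesis
  proof (intro exI[of _ "r ` cells"] conjI ballI)
    have "r ` cells \<subseteq> {T\<in>cells. T \<inter> G \<noteq> {}}" using r by (auto simp: Q_def)
    then show "finite (r ` cells)" "r ` cells \<subseteq> cells"
      using finite_cells_meeting_G finite_subset by (blast, blast)
    fix T assume T: "T \<in> cells"
    obtain v where v: "v \<in> V" "(*) v ` T = r T" using r[OF T] by (auto simp: Q_def)
    show "\<exists>!p. p \<in> r ` cells \<times> V \<and> (*) (snd p) ` T = fst p"
    proof (rule ex1I[of _ "(r T, v)"])
      show "(r T, v) \<in> r ` cells \<times> V \<and> (*) (snd (r T, v)) ` T = fst (r T, v)" using T v by auto
      fix p assume p: "p \<in> r ` cells \<times> V \<and> (*) (snd p) ` T = fst p"
      then obtain T' where T': "T' \<in> cells" "fst p = r T'" by auto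
      obtain v' where v': "v' \<in> V" "(*) v' ` T' = r T'" using r[OF T'(1)] by (auto simp: Q_def)
      have "r T' = r (r T')" using r_mult[OF v'(1), of T'] v' by simp
      also have "\<dots> = r T" using p T'(2) r_mult[of "snd p" T] by auto
      finally have "r T' = r T" .
      moreover have "snd p = v" using cells_free[OF T _ v(1)] p v(2) T'(2) \<open>r T' = r T\<close> by auto
      ultimately show "p = (r T, v)" using T'(2) by (metis prod.collapse)
    qed
  qed
qed

text \<open>Omitting one of the n vertices leaves a transversal set of fewer than n points, to which
  \<open>generic_axis\<close> applies.\<close>

lemma cell_basis:
  assumes "T \<in> cells"
  shows "\<exists>f::'n \<Rightarrow> real^'n. inj f \<and> range f = T \<and> is_basis f \<and> range f \<subseteq> pos_orthant \<and> generic_for l f"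
proof -
  obtain h where h: "T = active S h" "h \<in> P" "card T = CARD('n)" using assms by (auto simp: cells_def)
  have fin: "finite T" using finite_active h by auto
  obtain f :: "'n \<Rightarrow> real^'n" where f: "bij_betw f UNIV T"
    using finite_same_card_bij[of "UNIV::'n set" T] fin h(3) by auto
  have inj: "inj f" and range: "range f = T" using f by (auto simp: bij_betw_def)
  have ind: "independent T" using active_independent h by auto
  have span: "span T = UNIV"
    using card_ge_dim_independent[of T UNIV] ind h(3) by auto
  have "axis l 1 \<notin> span (f ` (UNIV - {i}))" for i
  proof (rule generic_axis)
    have sub: "f ` (UNIV - {i}) \<subseteq> T" using range by auto
    then show "f ` (UNIV - {i}) \<subseteq> S" "finite (f ` (UNIV - {i}))" using h by (auto simp: active_def)
    show "transversal V (f ` (UNIV - {i}))"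
      using transversal_subset[OF active_transversal[OF h(2)]] sub h(1) by auto
    have "card (f ` (UNIV - {i})) \<le> card (UNIV - {i})" by (rule card_image_le) simp
    also have "\<dots> < CARD('n)" by (simp add: card_Diff_singleton)
    finally show "card (f ` (UNIV - {i})) < CARD('n)" .
  qed
  moreover have "T \<subseteq> pos_orthant" using S_pos h by (auto simp: active_def pos_orthant_def)
  ultimately show ?thesis
    using inj range ind span by (intro exI[of _ f]) (auto simp: is_basis_def generic_for_def)
qed

text \<open>A point \<open>x\<close> lies in the shifted cone of exactly one cell \<open>T\<close>.
  Hence \<open>v * x\<close> lies in the shifted cone of a representative \<open>R\<close> exactly
  when \<open>v\<close> carries \<open>T\<close> to \<open>R\<close>, and there is one such
  pair.\<close>

theorem ex_effective_shintani_decomposition: "\<exists>\<B>. effective_shintani_decomposition l V \<B>"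
proof -
  from cell_representatives obtain \<R> where "finite \<R> \<and> \<R> \<subseteq> cells \<and>
      (\<forall>T\<in>cells. \<exists>!p. p \<in> \<R> \<times> V \<and> (*) (snd p) ` T = fst p)" by (elim exE)
  then have \<R>: "finite \<R>" "\<R> \<subseteq> cells"
    "\<And>T. T \<in> cells \<Longrightarrow> \<exists>!p. p \<in> \<R> \<times> V \<and> (*) (snd p) ` T = fst p" by (elim conjE; simp)+
  have "\<forall>T\<in>cells. \<exists>f::'n \<Rightarrow> real^'n. inj f \<and> range f = T \<and> is_basis f \<and>
      range f \<subseteq> pos_orthant \<and> generic_for l f"
    using cell_basis by (rule ballI)
  from bchoice[OF this] obtain b where "\<forall>T\<in>cells. inj (b T) \<and> range (b T) = T \<and>
      is_basis (b T) \<and> range (b T) \<subseteq> pos_orthant \<and> generic_for l (b T)"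
    by (elim exE)
  note b = bspec[OF this]
  have sc: "shifted_cone l (b R) = shifted_simplicial_cone l R" if "R \<in> \<R>" for R
    using shifted_cone_eq_shifted_simplicial_cone[of "b R" l] b[of R] that \<R>(2) by auto
  have "\<exists>!p. p \<in> b ` \<R> \<times> V \<and> snd p * x \<in> shifted_cone l (fst p)" if x: "x \<in> pos_orthant" for x
  proof -
    obtain T where T: "T \<in> cells" "x \<in> shifted_simplicial_cone l T" using cells_cover[OF x] by blast
    have iff: "v * x \<in> shifted_simplicial_cone l R \<longleftrightarrow> (*) v ` T = R" if "R \<in> \<R>" "v \<in> V" for R v
    proof -
      have "v * x \<in> shifted_simplicial_cone l ((*) v ` T)"
        using shifted_simplicial_cone_mult[of v x l T] V_simps(1)[OF that(2)] T(2) by auto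
      then show ?thesis
        using cells_shifted_unique[of "(*) v ` T" R "v * x"] cells_mult[OF that(2) T(1)] that(1) \<R>(2) by auto
    qed
    obtain p where p: "p \<in> \<R> \<times> V" "(*) (snd p) ` T = fst p"
      "\<And>q. q \<in> \<R> \<times> V \<Longrightarrow> (*) (snd q) ` T = fst q \<Longrightarrow> q = p"
      using \<R>(3)[OF T(1)] by (metis (no_types, lifting))
    show ?thesis
    proof (rule ex1I[of _ "(b (fst p), snd p)"])
      show "(b (fst p), snd p) \<in> b ` \<R> \<times> V \<and>
          snd (b (fst p), snd p) * x \<in> shifted_cone l (fst (b (fst p), snd p))"
        using p(1,2) iff[of "fst p" "snd p"] sc[of "fst p"] by (auto simp: mem_Times_iff)
      fix q assume q: "q \<in> b ` \<R> \<times> V \<and> snd q * x \<in> shifted_cone l (fst q)"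
      then obtain R where R: "R \<in> \<R>" "fst q = b R" "snd q \<in> V" by (auto simp: mem_Times_iff)
      then have "(*) (snd q) ` T = R" using q iff[of R "snd q"] sc[of R] by auto
      then have "(R, snd q) = p" using p(3)[of "(R, snd q)"] R by auto
      then show "q = (b (fst p), snd p)" using R by (metis fst_conv prod.collapse snd_conv)
    qed
  qed
  then have "\<forall>x\<in>pos_orthant. \<exists>!p. p \<in> b ` \<R> \<times> V \<and> snd p * x \<in> shifted_cone l (fst p)"
    by (rule ballI)
  moreover have "\<forall>f\<in>b ` \<R>. is_basis f \<and> range f \<subseteq> pos_orthant" "\<forall>f\<in>b ` \<R>. generic_for l f"
    using b subsetD[OF \<R>(2)] by blast+
  ultimately show ?thesis
    unfolding effective_shintani_decomposition_def using \<R>(1)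
    by (intro exI[of _ "b ` \<R>"] conjI finite_imageI)
qed

end

section \<open>Lattices of the positive orthant\<close>

lemma lattice_in_scaleR_int:
  assumes "lattice_in H L" "x \<in> L"
  shows "of_int k *\<^sub>R x \<in> L"
proof -
  have nat: "of_nat m *\<^sub>R x \<in> L" for m
    using assms by (induction m) (auto simp: lattice_in_def scaleR_add_left)
  show ?thesis
  proof (cases "k \<ge> 0")
    case True then show ?thesis using nat[of "nat k"] by simp
  next
    case False
    then have "- (of_nat (nat (- k)) *\<^sub>R x) \<in> L" using nat assms unfolding lattice_in_def by blast
    then show ?thesis using False by simp
  qed
qed

lemma lattice_in_sum:
  assumes "lattice_in H L" "\<And>b. b \<in> B \<Longrightarrow> f b \<in> L"
  shows "sum f B \<in> L"
  using assms by (induction B rule: infinite_finite_induct) (auto simp: lattice_in_def)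

text \<open>Rounding down the coordinates in a basis of \<open>H\<close> taken from \<open>L\<close>
  leaves fractional parts. The basis need not generate \<open>L\<close>; lying in \<open>L\<close>
  and spanning \<open>H\<close> is enough.\<close>

lemma lattice_in_cocompact:
  assumes "lattice_in H L"
  shows "\<exists>R. \<forall>x\<in>H. \<exists>y\<in>L. norm (x - y) \<le> R"
proof -
  obtain B where B: "B \<subseteq> L" "independent B" "L \<subseteq> span B"
    using maximal_independent_subset by blast
  have fin: "finite B" using B(2) by (rule independent_imp_finite)
  have H: "H \<subseteq> span B"
    using span_mono[OF B(3)] assms by (auto simp: lattice_in_def span_span)
  show ?thesis
  proof (intro exI[of _ "\<Sum>b\<in>B. norm b"] ballI)
    fix x assume "x \<in> H"
    then obtain u where x: "x = (\<Sum>b\<in>B. u b *\<^sub>R b)" using H span_finite[OF fin] by auto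
    define y where "y = (\<Sum>b\<in>B. of_int \<lfloor>u b\<rfloor> *\<^sub>R b)"
    have "y \<in> L"
      unfolding y_def using B(1) by (intro lattice_in_sum[OF assms] lattice_in_scaleR_int[OF assms]) auto
    moreover have "x - y = (\<Sum>b\<in>B. frac (u b) *\<^sub>R b)"
      by (simp add: x y_def frac_def scaleR_diff_left sum_subtractf)
    then have "norm (x - y) \<le> (\<Sum>b\<in>B. norm (frac (u b) *\<^sub>R b))" by (simp only: norm_sum)
    then have "norm (x - y) \<le> (\<Sum>b\<in>B. norm b)"
      by (rule order_trans)
        (auto intro!: sum_mono mult_left_le_one_le less_imp_le[OF frac_lt_1])
    ultimately show "\<exists>y\<in>L. norm (x - y) \<le> (\<Sum>b\<in>B. norm b)" by blast
  qed
qed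

text \<open>Translation in the group carries the isolation radius at 0 to every point.\<close>

lemma lattice_in_uniform_discrete:
  assumes "lattice_in H L"
  shows "\<exists>d>0. \<forall>x\<in>L. \<forall>y\<in>L. norm (x - y) < d \<longrightarrow> x = y"
proof -
  have "0 isolated_in L" using assms by (auto simp: lattice_in_def discrete_def)
  then obtain d where d: "d > 0" "\<And>x. x \<in> L \<Longrightarrow> norm x < d \<Longrightarrow> x = 0"
    by (auto simp: isolated_in_dist_Ex_iff)
  have "x = y" if "x \<in> L" "y \<in> L" "norm (x - y) < d" for x y
  proof -
    have "x + (- y) \<in> L" using assms that unfolding lattice_in_def by blast
    then show ?thesis using d(2)[of "x - y"] that(3) by simp
  qed
  then show ?thesis using d(1) by blast
qed

lemma lattice_in_finite_bounded:
  assumes "lattice_in H L"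
  shows "finite {x\<in>L. norm x \<le> C}"
proof -
  obtain d where "d > 0" "\<forall>x\<in>L. \<forall>y\<in>L. norm (x - y) < d \<longrightarrow> x = y"
    using lattice_in_uniform_discrete[OF assms] by blast
  then have "uniform_discrete {x\<in>L. norm x \<le> C}"
    unfolding uniform_discrete_def dist_norm by blast
  moreover have "bounded {x\<in>L. norm x \<le> C}" by (auto simp: bounded_iff)
  ultimately show ?thesis using uniform_discrete_finite_iff by blast
qed

section \<open>The norm-one surface and multiplicative forms of the lattice properties\<close>

definition norm_one_surface :: "(real^'n) set" where
  "norm_one_surface = {p. (\<forall>i. 0 < p $ i) \<and> (\<Prod>i\<in>UNIV. p $ i) = 1}"

lemma Log_component: "0 < z $ i \<Longrightarrow> Log z $ i = ln (z $ i)"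
  by (simp add: Log_def)

lemma Log_in_sum_zero_hyperplane_iff:
  assumes "\<And>i. 0 < z $ i"
  shows "Log z \<in> sum_zero_hyperplane \<longleftrightarrow> z \<in> norm_one_surface"
proof -
  have pos: "0 < (\<Prod>i\<in>UNIV. z $ i)" using assms by (intro prod_pos) auto
  have "(\<Sum>i\<in>UNIV. Log z $ i) = ln (\<Prod>i\<in>UNIV. z $ i)"
    using assms by (simp add: Log_component ln_prod less_imp_neq[symmetric])
  then show ?thesis
    using pos assms by (simp add: sum_zero_hyperplane_def norm_one_surface_def)
qed

lemma pos_lattice_norm_one:
  assumes "pos_lattice V"
  shows "V \<subseteq> norm_one_surface"
proof
  fix v assume v: "v \<in> V"
  obtain L where L: "lattice_in sum_zero_hyperplane L" "bij_betw Log V L"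
    using assms by (auto simp: pos_lattice_def)
  have "Log v \<in> sum_zero_hyperplane"
    using bij_betwE[OF L(2)] v L(1) unfolding lattice_in_def by blast
  moreover have "0 < v $ i" for i using assms v pos_subgroupD(1) by (auto simp: pos_lattice_def)
  ultimately show "v \<in> norm_one_surface" using Log_in_sum_zero_hyperplane_iff by blast
qed

text \<open>Upper bounds suffice: the logarithms sum to 0, so a bound above on all of them also
  bounds each from below.\<close>

lemma pos_lattice_finite_bounded:
  fixes V :: "(real^'n) set"
  assumes "pos_lattice V"
  shows "finite {v\<in>V. \<forall>i. v $ i \<le> C}"
proof -
  obtain L where L: "lattice_in sum_zero_hyperplane L" "bij_betw Log V L"
    using assms by (auto simp: pos_lattice_def)
  have sub: "pos_subgroup V" using assms by (simp add: pos_lattice_def)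
  define M where "M = ln (max 1 C)"
  have M: "0 \<le> M" by (simp add: M_def)
  define N where "N = (\<Sum>i\<in>(UNIV::'n set). real CARD('n) * M)"
  have bound: "norm (Log v) \<le> N" if v: "v \<in> V" "\<forall>i. v $ i \<le> C" for v
  proof -
    have pos: "0 < v $ i" for i using pos_subgroupD(1)[OF sub v(1)] .
    have "Log v \<in> sum_zero_hyperplane"
      using pos_lattice_norm_one[OF assms] v(1) Log_in_sum_zero_hyperplane_iff[OF pos] by blast
    then have sum0: "(\<Sum>i\<in>UNIV. Log v $ i) = 0" by (simp add: sum_zero_hyperplane_def)
    have up: "Log v $ i \<le> M" for i
      using v(2) pos[of i] by (simp add: Log_component M_def le_max_iff_disj)
    have "\<bar>Log v $ i\<bar> \<le> real CARD('n) * M" for i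
    proof -
      have "0 = Log v $ i + (\<Sum>j\<in>UNIV - {i}. Log v $ j)"
        using sum0 by (simp add: sum.remove[of UNIV i])
      also have "(\<Sum>j\<in>UNIV - {i}. Log v $ j) \<le> (\<Sum>j\<in>UNIV - {i}. M)"
        using up by (intro sum_mono) auto
      also have "\<dots> \<le> (\<Sum>j\<in>(UNIV::'n set). M)" using M by (intro sum_mono2) auto
      also have "\<dots> = real CARD('n) * M" by simp
      finally have "- (real CARD('n) * M) \<le> Log v $ i" by simp
      moreover have "M \<le> real CARD('n) * M" using M by (intro mult_le_cancel_right1[THEN iffD2]) auto
      ultimately show ?thesis using up[of i] by (simp add: abs_le_iff)
    qed
    then show ?thesis
      unfolding N_def by (intro order_trans[OF norm_le_l1_cart] sum_mono) auto
  qed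
  have "Log ` {v\<in>V. \<forall>i. v $ i \<le> C} \<subseteq> {x\<in>L. norm x \<le> N}"
    using bound L(2) by (auto dest: bij_betwE)
  then have "finite (Log ` {v\<in>V. \<forall>i. v $ i \<le> C})"
    using lattice_in_finite_bounded[OF L(1)] finite_subset by blast
  moreover have "inj_on Log {v\<in>V. \<forall>i. v $ i \<le> C}"
    using L(2) by (auto simp: bij_betw_def intro: inj_on_subset)
  ultimately show ?thesis by (rule finite_imageD)
qed

lemma pos_lattice_countable:
  assumes "pos_lattice V"
  shows "countable V"
proof -
  have "V \<subseteq> (\<Union>k. {v\<in>V. \<forall>i. v $ i \<le> real k})"
  proof
    fix v assume v: "v \<in> V"
    obtain k where "Max (range (($) v)) \<le> real k" using real_arch_simple by blast
    then have "\<forall>i. v $ i \<le> real k" by (auto intro: order_trans[OF Max_ge])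
    then show "v \<in> (\<Union>k. {v\<in>V. \<forall>i. v $ i \<le> real k})" using v by blast
  qed
  moreover have "countable (\<Union>k. {v\<in>V. \<forall>i. v $ i \<le> real k})"
    by (rule countable_UN[OF _ countable_finite[OF pos_lattice_finite_bounded[OF assms]]]) simp
  ultimately show ?thesis by (rule countable_subset)
qed

lemma pos_lattice_discrete:
  fixes V :: "(real^'n) set"
  assumes "pos_lattice V"
  shows "\<exists>d>0. \<forall>v\<in>V. (\<forall>i. \<bar>ln (v $ i)\<bar> \<le> d) \<longrightarrow> v = 1"
proof -
  obtain L where L: "lattice_in sum_zero_hyperplane L" "bij_betw Log V L"
    using assms by (auto simp: pos_lattice_def)
  have sub: "pos_subgroup V" using assms by (simp add: pos_lattice_def)
  obtain d where d: "d > 0" "\<forall>x\<in>L. \<forall>y\<in>L. norm (x - y) < d \<longrightarrow> x = y"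
    using lattice_in_uniform_discrete[OF L(1)] by blast
  \<comment> \<open>Summing over n coordinates gives an l1 bound of d/2, which is strictly below
    d.\<close>
  let ?d = "d / (2 * real CARD('n))"
  show ?thesis
  proof (intro exI[of _ ?d] conjI ballI impI)
    show "0 < ?d" using d(1) by simp
    fix v assume v: "v \<in> V" "\<forall>i. \<bar>ln (v $ i)\<bar> \<le> ?d"
    have one: "1 \<in> V" using pos_subgroupD[OF sub] by blast
    have Log1: "Log 1 = (0::real^'n)" by (simp add: Log_def vec_eq_iff)
    have "norm (Log v) \<le> (\<Sum>i\<in>UNIV. \<bar>Log v $ i\<bar>)" by (rule norm_le_l1_cart)
    also have "\<dots> \<le> (\<Sum>i\<in>(UNIV::'n set). ?d)"
      using v pos_subgroupD(1)[OF sub v(1)] by (intro sum_mono) (simp add: Log_component)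
    also have "\<dots> < d" using d(1) by simp
    finally have "norm (Log v - Log 1) < d" by (simp add: Log1)
    then have "Log v = Log 1" using d(2) L(2) v(1) one by (auto dest: bij_betwE)
    then show "v = 1" using L(2) v(1) one by (auto simp: bij_betw_def dest: inj_onD)
  qed
qed

lemma pos_lattice_cocompact:
  fixes V :: "(real^'n) set"
  assumes "pos_lattice V"
  shows "\<exists>R. \<forall>p\<in>norm_one_surface. \<exists>v\<in>V. \<forall>i. exp (- R) \<le> (v * p) $ i \<and> (v * p) $ i \<le> exp R"
proof -
  obtain L where L: "lattice_in sum_zero_hyperplane L" "bij_betw Log V L"
    using assms by (auto simp: pos_lattice_def)
  have sub: "pos_subgroup V" using assms by (simp add: pos_lattice_def)
  obtain R where R: "\<And>x. x \<in> sum_zero_hyperplane \<Longrightarrow> \<exists>y\<in>L. norm (x - y) \<le> R"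
    using lattice_in_cocompact[OF L(1)] by blast
  show ?thesis
  proof (intro exI[of _ R] ballI)
    fix p :: "real^'n" assume p: "p \<in> norm_one_surface"
    then have pos: "0 < p $ i" for i by (simp add: norm_one_surface_def)
    obtain y where y: "y \<in> L" "norm (Log p - y) \<le> R"
      using R[of "Log p"] p Log_in_sum_zero_hyperplane_iff[OF pos] by blast
    then obtain w where w: "w \<in> V" "Log w = y" using L(2) by (auto simp: bij_betw_def)
    have wpos: "0 < w $ i" for i using pos_subgroupD(1)[OF sub w(1)] .
    have "exp (- R) \<le> (vinv w * p) $ i \<and> (vinv w * p) $ i \<le> exp R" for i
    proof -
      have "(vinv w * p) $ i = p $ i / w $ i" by (simp add: field_simps)
      also have "\<dots> = exp (ln (p $ i) - ln (w $ i))"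
        using pos[of i] wpos[of i] by (simp add: exp_diff)
      finally have eq: "(vinv w * p) $ i = exp (ln (p $ i) - ln (w $ i))" .
      have "\<bar>(Log p - Log w) $ i\<bar> \<le> R"
        using component_le_norm_cart[of "Log p - Log w" i] y w by simp
      then have "\<bar>ln (p $ i) - ln (w $ i)\<bar> \<le> R"
        using pos[of i] wpos[of i] by (simp add: Log_component)
      then show ?thesis unfolding eq by auto
    qed
    then show "\<exists>v\<in>V. \<forall>i. exp (- R) \<le> (v * p) $ i \<and> (v * p) $ i \<le> exp R"
      using pos_subgroupD(4)[OF sub w(1)] by blast
  qed
qed

section \<open>General position\<close>

definition generic :: "(real^'n) set \<Rightarrow> 'n \<Rightarrow> (real^'n) set \<Rightarrow> bool" where
  "generic V l G \<longleftrightarrow> (\<forall>T. finite T \<longrightarrow> T \<subseteq> orbits V G \<longrightarrow> transversal V T \<longrightarrow>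
     (card T \<le> Suc CARD('n) \<longrightarrow> \<not> affine_dependent T) \<and>
     (card T < CARD('n) \<longrightarrow> axis l 1 \<notin> span T))"

lemma negligible_affine_hull_small:
  fixes T :: "'a::euclidean_space set"
  assumes "finite T" "card T \<le> DIM('a)"
  shows "negligible (affine hull T)"
  using negligible_convex_interior[of "affine hull T"] empty_interior_affine_hull[OF assms]
  by (simp add: affine_imp_convex)

text \<open>A transversal set not contained in the old orbits has exactly one point
  \<open>v * g\<close> outside them. It can only fail if \<open>v * g\<close> lies in the affine
  hull of the remaining points or, by exchange, in their span together with \<open>axis l 1\<close>;
  both put \<open>g\<close> in an excluded translate.\<close>

lemma generic_insert:
  fixes V :: "(real^'n) set"
  assumes V: "pos_subgroup V" and G: "generic V l G"
    and aff: "\<And>w T. w \<in> V \<Longrightarrow> finite T \<Longrightarrow> T \<subseteq> orbits V G \<Longrightarrow> card T \<le> CARD('n) \<Longrightarrow>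
      g \<notin> (*) w ` (affine hull T)"
    and lin: "\<And>w T. w \<in> V \<Longrightarrow> finite T \<Longrightarrow> T \<subseteq> orbits V G \<Longrightarrow> Suc (card T) < CARD('n) \<Longrightarrow>
      g \<notin> (*) w ` span (insert (axis l 1) T)"
  shows "generic V l (insert g G)"
  unfolding generic_def
proof (intro allI impI)
  fix T assume T: "finite T" "T \<subseteq> orbits V (insert g G)" "transversal V T"
  show "(card T \<le> Suc CARD('n) \<longrightarrow> \<not> affine_dependent T) \<and> (card T < CARD('n) \<longrightarrow> axis l 1 \<notin> span T)"
  proof (cases "T \<subseteq> orbits V G")
    case True
    then show ?thesis using G T unfolding generic_def by blast
  next
    case False
    then obtain t where t: "t \<in> T" "t \<notin> orbits V G" by blast
    then obtain v h where vh: "t = v * h" "v \<in> V" "h \<in> insert g G" using T(2) by (auto simp: orbits_def)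
    then have "h = g" using t(2) by (auto simp: orbits_def)
    then have v: "v \<in> V" "v * g \<in> T" using vh t(1) by auto
    have nz: "v $ i \<noteq> 0" for i using pos_subgroupD(1)[OF V v(1), of i] by simp
    let ?s = "v * g" and ?T = "T - {v * g}"
    have g: "g \<in> (*) (vinv v) ` X" if "?s \<in> X" for X
      using that vinv_mult_cancel(1)[of v g] nz by (metis imageI)
    have sub: "?T \<subseteq> orbits V G"
    proof
      fix t assume t: "t \<in> ?T"
      then obtain w h where w: "t = w * h" "w \<in> V" "h \<in> insert g G" using T(2) by (auto simp: orbits_def)
      have "h \<noteq> g"
      proof
        assume hg: "h = g"
        have "(w * vinv v) * ?s = t"
          using vinv_mult_cancel(1)[of v g] nz w hg by (simp add: mult.assoc)
        moreover have "w * vinv v \<in> V" using w v pos_subgroupD[OF V] by blast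
        ultimately have "w * vinv v = 1" using T(3) v(2) t by (auto simp: transversal_def)
        then show False using \<open>(w * vinv v) * ?s = t\<close> t by simp
      qed
      then show "t \<in> orbits V G" using w by (auto simp: orbits_def)
    qed
    have fin: "finite ?T" and T_eq: "T = insert ?s ?T" and card: "card T = Suc (card ?T)"
      using T(1) v(2) card.remove[of T ?s] by auto
    have IH: "card ?T \<le> Suc CARD('n) \<Longrightarrow> \<not> affine_dependent ?T"
      "card ?T < CARD('n) \<Longrightarrow> axis l 1 \<notin> span ?T"
      using G fin sub transversal_subset[OF T(3), of ?T] unfolding generic_def by auto
    show ?thesis
    proof (intro conjI impI)
      assume c: "card T \<le> Suc CARD('n)"
      have "?s \<notin> affine hull ?T"
        using aff[of "vinv v" ?T] g[of "affine hull ?T"] fin sub c card pos_subgroupD(4)[OF V v(1)] by auto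
      then show "\<not> affine_dependent T"
        using affine_independent_insert[of ?T ?s] IH(1) c card T_eq by simp
    next
      assume c: "card T < CARD('n)"
      show "axis l 1 \<notin> span T"
      proof
        assume "axis l 1 \<in> span T"
        then have "axis l 1 \<in> span (insert ?s ?T)" using T_eq by simp
        then have "?s \<in> span (insert (axis l 1) ?T)"
          by (rule in_span_insert) (use IH(2) c card in auto)
        then show False
          using lin[of "vinv v" ?T] g fin sub c card pos_subgroupD(4)[OF V v(1)] by auto
      qed
    qed
  qed
qed

text \<open>Representatives are added one at a time. Each set to be avoided is the image under some
  \<open>v\<close> in \<open>V\<close> of an affine subspace of dimension below n, so it is
  negligible; there are countably many of them, and they cannot cover a nonempty open set.\<close>

lemma ex_generic:
  fixes V :: "(real^'n) set"
  assumes V: "pos_subgroup V" "countable V"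
    and "finite \<U>" "\<And>U. U \<in> \<U> \<Longrightarrow> open U \<and> U \<noteq> {}"
  shows "\<exists>G. finite G \<and> G \<subseteq> \<Union>\<U> \<and> (\<forall>U\<in>\<U>. G \<inter> U \<noteq> {}) \<and> generic V l G"
  using assms(3,4)
proof (induction \<U> rule: finite_induct)
  case empty
  have "generic V l {}" by (auto simp: generic_def orbits_def)
  then show ?case by auto
next
  case (insert U \<U>)
  then obtain G where G: "finite G" "G \<subseteq> \<Union>\<U>" "\<forall>U\<in>\<U>. G \<inter> U \<noteq> {}" "generic V l G" by auto
  define F where "F = {T. finite T \<and> T \<subseteq> orbits V G}"
  define A where "A = (\<lambda>(w, T). (*) w ` (affine hull T)) ` (V \<times> {T\<in>F. card T \<le> CARD('n)})"
  define B where "B = (\<lambda>(w, T). (*) w ` span (insert (axis l 1) T)) ` (V \<times> {T\<in>F. Suc (card T) < CARD('n)})"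
  have "orbits V G = (\<lambda>(v, g). v * g) ` (V \<times> G)" by (auto simp: orbits_def)
  then have "countable (orbits V G)" using V(2) G(1) by (simp add: countable_finite)
  then have "countable F" unfolding F_def by (rule countable_Collect_finite_subset)
  then have cnt: "countable (A \<union> B)"
    unfolding A_def B_def using V(2)
    by (intro countable_Un countable_image countable_SIGMA) (auto intro: countable_subset)
  have neg: "negligible X" if "X \<in> A \<union> B" for X
  proof -
    have "negligible ((*) w ` X)" if "negligible X" for w :: "real^'n" and X
      using that by (rule negligible_differentiable_image_negligible[OF order_refl])
        (rule linear_imp_differentiable_on[OF linear_mult_left_vec])
    moreover have "negligible (affine hull T)" if "T \<in> F" "card T \<le> CARD('n)" for T
      using that negligible_affine_hull_small[of T] by (auto simp: F_def)
    moreover have "negligible (span (insert (axis l 1) T))" if "T \<in> F" "Suc (card T) < CARD('n)" for T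
    proof (rule negligible_lowdim)
      have "dim (span (insert (axis l 1) T)) \<le> card (insert (axis l 1) T)"
        using that by (auto simp: F_def dim_span intro: dim_le_card')
      also have "\<dots> \<le> Suc (card T)" by (rule card_insert_le_m1) simp_all
      finally show "dim (span (insert (axis l 1) T)) < DIM(real^'n)" using that(2) by simp
    qed
    ultimately show ?thesis using that by (auto simp: A_def B_def)
  qed
  have "negligible (\<Union>(A \<union> B))" by (rule negligible_countable_Union[OF cnt neg])
  moreover have "\<not> negligible U" using insert.prems[of U] open_not_negligible by blast
  ultimately obtain g where g: "g \<in> U" "g \<notin> \<Union>(A \<union> B)" by (meson negligible_subset subsetI)
  have "generic V l (insert g G)"
    by (rule generic_insert[OF V(1) G(4)]) (use g(2) in \<open>auto simp: A_def B_def F_def\<close>)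
  then show ?case
    using G g by (intro exI[of _ "insert g G"]) auto
qed

section \<open>Faces of dense sets of orbits\<close>

text \<open>With u = ln y the defect is exp u - 1 - u, which vanishes only at 0 and beyond d or -d
  is at least its value there. Halving the smaller of these two values gives a strict
  threshold.\<close>

lemma abs_ln_le_of_defect_le:
  fixes d :: real
  assumes "0 < d"
  shows "\<exists>c>0. \<forall>y>0. y - 1 - ln y \<le> c \<longrightarrow> \<bar>ln y\<bar> \<le> d"
proof -
  define f where "f u = exp u - 1 - u" for u :: real
  have fpos: "0 < f u" if "u \<noteq> 0" for u
  proof -
    have "exp u - 1 \<noteq> u" using ln_eq_minus_one[of "exp u"] that by auto
    then show ?thesis using exp_ge_add_one_self[of u] unfolding f_def by linarith
  qed
  have up: "f d \<le> f u" if "d \<le> u" for u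
  proof -
    have "u - d \<le> exp (u - d) - 1" using exp_ge_add_one_self[of "u - d"] by linarith
    also have "\<dots> \<le> exp d * (exp (u - d) - 1)"
      using assms that by (simp add: mult_le_cancel_right1)
    also have "\<dots> = exp u - exp d" by (simp add: algebra_simps exp_diff)
    finally show ?thesis by (simp add: f_def)
  qed
  have down: "f (- d) \<le> f u" if "u \<le> - d" for u
  proof -
    have "exp (- d) - exp u = exp (- d) * (1 - exp (u + d))" by (simp add: algebra_simps exp_add exp_minus)
    also have "\<dots> \<le> 1 * (1 - exp (u + d))"
      using assms that by (intro mult_right_mono) auto
    also have "\<dots> \<le> - d - u" using exp_ge_add_one_self[of "u + d"] unfolding mult_1 by linarith
    finally show ?thesis by (simp add: f_def)
  qed
  let ?c = "min (f d) (f (- d)) / 2"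
  have c: "0 < ?c" "?c < f d" "?c < f (- d)" using fpos[of d] fpos[of "- d"] assms by auto
  have "\<bar>ln y\<bar> \<le> d" if y: "0 < y" "y - 1 - ln y \<le> ?c" for y
  proof -
    have "f (ln y) \<le> ?c" using y by (simp add: f_def)
    then show ?thesis using up[of "ln y"] down[of "ln y"] c by linarith
  qed
  then show ?thesis using c(1) by blast
qed

text \<open>The defects are nonnegative and their sum is the sum of the \<open>y i\<close>, minus n,
  minus the logarithm of the product; so each single one is at most \<open>c\<close>.\<close>

lemma defect_le_of_sum_le:
  fixes y :: "'n::finite \<Rightarrow> real"
  assumes pos: "\<And>i. 0 < y i" and prod: "1 \<le> (\<Prod>i\<in>UNIV. y i)"
    and sum: "(\<Sum>i\<in>UNIV. y i) \<le> real CARD('n) + c"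
  shows "y i - 1 - ln (y i) \<le> c"
proof -
  have nn: "0 \<le> y j - 1 - ln (y j)" for j using ln_le_minus_one[OF pos[of j]] by simp
  have "y i - 1 - ln (y i) \<le> (\<Sum>j\<in>UNIV. y j - 1 - ln (y j))"
    using nn by (intro member_le_sum) auto
  also have "\<dots> = (\<Sum>j\<in>UNIV. y j) - real CARD('n) - ln (\<Prod>j\<in>UNIV. y j)"
    using pos by (simp add: sum_subtractf ln_prod less_imp_neq[symmetric])
  also have "\<dots> \<le> c" using sum ln_ge_zero[OF prod] by simp
  finally show ?thesis .
qed

text \<open>On the norm-one surface a positive functional \<open>h\<close> is minimal at the point \<open>p\<close> with
  \<open>p $ i\<close> proportional to \<open>1 / h $ i\<close>. A set \<open>S\<close> that is dense up to the factor \<open>r\<close> has a point near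
  \<open>p\<close>, so a point of \<open>S\<close> on the face supported by \<open>h\<close> almost attains equality in AM-GM.\<close>

lemma active_near_minimizer:
  fixes S :: "(real^'n) set"
  assumes dense: "\<And>p. p \<in> norm_one_surface \<Longrightarrow> \<exists>s\<in>S. \<forall>i. s $ i \<le> r * p $ i"
    and S: "\<And>s i. s \<in> S \<Longrightarrow> 0 < s $ i" "\<And>s. s \<in> S \<Longrightarrow> 1 \<le> (\<Prod>i\<in>UNIV. s $ i)"
    and h: "h \<in> dual_poly S" "\<And>i. 0 < h $ i"
    and r: "0 < r" "real CARD('n) * r \<le> real CARD('n) + c"
  shows "\<exists>k. 0 < k \<and> (\<forall>s\<in>active S h. \<forall>i. h $ i * s $ i / k - 1 - ln (h $ i * s $ i / k) \<le> c)"
proof -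
  let ?n = "CARD('n)"
  \<comment> \<open>The geometric mean of the coordinates of \<open>h\<close>: it makes the
    coordinates \<open>k / h $ i\<close> of \<open>p\<close> have product 1. Comparing with a point
    of \<open>S\<close> near \<open>p\<close> gives \<open>1 / k \<le> n * r\<close>, and
    \<open>1 / k\<close> is the sum of the numbers \<open>h $ i * s $ i / k\<close> for active
    \<open>s\<close>.\<close>
  define k where "k = root ?n (\<Prod>i\<in>UNIV. h $ i)"
  have hprod: "0 < (\<Prod>i\<in>UNIV. h $ i)" using h(2) by (intro prod_pos) auto
  then have k: "0 < k" "k ^ ?n = (\<Prod>i\<in>UNIV. h $ i)" by (simp_all add: k_def)
  have hnz: "h $ i \<noteq> 0" for i using h(2)[of i] by simp
  define p :: "real^'n" where "p = (\<chi> i. k / h $ i)"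
  have "p \<in> norm_one_surface"
    using k h(2) hnz hprod by (simp add: norm_one_surface_def p_def prod_dividef)
  then obtain s0 where s0: "s0 \<in> S" "\<And>i. s0 $ i \<le> r * p $ i" using dense by blast
  have "1 \<le> h \<bullet> s0" using h(1) s0(1) by (simp add: dual_poly_def)
  also have "\<dots> \<le> (\<Sum>i\<in>UNIV. h $ i * (r * p $ i))"
    unfolding inner_vec_sum using s0(2) h(2) by (intro sum_mono mult_left_mono) (auto intro: less_imp_le)
  also have "\<dots> = (\<Sum>i\<in>(UNIV::'n set). r * k)"
    using hnz by (intro sum.cong) (auto simp: p_def)
  also have "\<dots> = real ?n * r * k" by simp
  finally have k1: "1 / k \<le> real ?n * r" using k by (simp add: field_simps)
  have "h $ i * s $ i / k - 1 - ln (h $ i * s $ i / k) \<le> c" if s: "s \<in> active S h" for s i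
  proof (rule defect_le_of_sum_le)
    have sS: "s \<in> S" "h \<bullet> s = 1" using s by (auto simp: active_def)
    show "0 < h $ j * s $ j / k" for j using h(2) S(1)[OF sS(1)] k by simp
    have "(\<Prod>j\<in>UNIV. h $ j * s $ j / k) = (\<Prod>j\<in>UNIV. s $ j)"
      using k hnz hprod by (simp add: prod_dividef prod.distrib)
    then show "1 \<le> (\<Prod>j\<in>UNIV. h $ j * s $ j / k)" using S(2)[OF sS(1)] by simp
    have "(\<Sum>j\<in>UNIV. h $ j * s $ j / k) = 1 / k"
      using sS(2) by (simp add: inner_vec_sum sum_divide_distrib[symmetric])
    then show "(\<Sum>j\<in>UNIV. h $ j * s $ j / k) \<le> real ?n + c" using k1 r(2) by linarith
  qed
  then show ?thesis using k(1) by blast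
qed

text \<open>The same \<open>k\<close> serves for \<open>s\<close> and \<open>v * s\<close>, so both
  normalized points have logarithms of size at most d/2. Their difference is the logarithm of
  \<open>v\<close>, of size at most d.\<close>

lemma active_transversal_of_dense:
  fixes S :: "(real^'n) set"
  assumes d: "\<forall>v\<in>V. (\<forall>i. \<bar>ln (v $ i)\<bar> \<le> d) \<longrightarrow> v = 1" and V: "\<And>v i. v \<in> V \<Longrightarrow> 0 < v $ i"
    and c: "\<forall>y>0. y - 1 - ln y \<le> c \<longrightarrow> \<bar>ln y\<bar> \<le> d / 2"
    and dense: "\<And>p. p \<in> norm_one_surface \<Longrightarrow> \<exists>s\<in>S. \<forall>i. s $ i \<le> r * p $ i"
    and S: "\<And>s i. s \<in> S \<Longrightarrow> 0 < s $ i" "\<And>s. s \<in> S \<Longrightarrow> 1 \<le> (\<Prod>i\<in>UNIV. s $ i)"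
    and h: "h \<in> dual_poly S" "\<And>i. 0 < h $ i"
    and r: "0 < r" "real CARD('n) * r \<le> real CARD('n) + c"
  shows "transversal V (active S h)"
  unfolding transversal_def
proof (intro ballI impI)
  fix s v assume s: "s \<in> active S h" and v: "v \<in> V" and vs: "v * s \<in> active S h"
  obtain k where k: "0 < k"
    "\<And>s i. s \<in> active S h \<Longrightarrow> h $ i * s $ i / k - 1 - ln (h $ i * s $ i / k) \<le> c"
    using active_near_minimizer[OF dense S h r] by blast
  have spos: "0 < s $ i" for i using s S(1) by (auto simp: active_def)
  have "\<bar>ln (v $ i)\<bar> \<le> d" for i
  proof -
    have pos: "0 < h $ i * s $ i / k" "0 < h $ i * (v * s) $ i / k"
      using h(2)[of i] spos[of i] k(1) V[OF v, of i] by simp_all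
    have "ln (h $ i * (v * s) $ i / k) = ln (v $ i) + ln (h $ i * s $ i / k)"
      using pos V[OF v, of i] by (subst ln_mult_pos[symmetric]) (simp_all add: algebra_simps)
    moreover have "\<bar>ln (h $ i * s $ i / k)\<bar> \<le> d / 2" "\<bar>ln (h $ i * (v * s) $ i / k)\<bar> \<le> d / 2"
      using c pos k(2)[OF s] k(2)[OF vs] by blast+
    ultimately show ?thesis by linarith
  qed
  then show "v = 1" using d v by blast
qed

text \<open>If \<open>h $ i\<close> were not positive, a point of \<open>S\<close> whose other
  coordinates are tiny would have \<open>h\<close>-value below 1. Such a point lies near a point of
  the surface with a very large i-th coordinate.\<close>

lemma dual_pos_of_dense:
  fixes S :: "(real^'n) set"
  assumes dense: "\<And>p. p \<in> norm_one_surface \<Longrightarrow> \<exists>s\<in>S. \<forall>i. s $ i \<le> r * p $ i"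
    and S: "\<And>s i. s \<in> S \<Longrightarrow> 0 < s $ i" and h: "h \<in> dual_poly S" and r: "0 < r"
  shows "0 < h $ i"
proof (rule ccontr)
  assume neg: "\<not> 0 < h $ i"
  \<comment> \<open>With \<open>M = r * a\<close>, a bound by r times 1/M becomes 1/a, so the other
    coordinates contribute at most (a - 1)/a < 1. The power of \<open>M\<close> in coordinate i
    makes the product of \<open>p\<close> equal to 1.\<close>
  define a where "a = 1 + (\<Sum>j\<in>UNIV. \<bar>h $ j\<bar>)"
  have a: "1 \<le> a" by (simp add: a_def sum_nonneg)
  define M where "M = r * a"
  have M: "0 < M" using r a by (simp add: M_def)
  define p :: "real^'n" where "p = (\<chi> j. if j = i then M ^ (CARD('n) - 1) else 1 / M)"
  have "(\<Prod>j\<in>UNIV. p $ j) = p $ i * (\<Prod>j\<in>UNIV - {i}. p $ j)" by (simp add: prod.remove)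
  also have "(\<Prod>j\<in>UNIV - {i}. p $ j) = (\<Prod>j\<in>UNIV - {i}. 1 / M)" by (intro prod.cong) (auto simp: p_def)
  also have "p $ i * \<dots> = 1" using M by (simp add: p_def card_Diff_singleton power_divide)
  finally have "p \<in> norm_one_surface" using M by (auto simp: norm_one_surface_def p_def)
  then obtain s where s: "s \<in> S" "\<And>j. s $ j \<le> r * p $ j" using dense by blast
  have "1 \<le> h \<bullet> s" using h s(1) by (simp add: dual_poly_def)
  also have "\<dots> \<le> (\<Sum>j\<in>UNIV. \<bar>h $ j\<bar> / a)"
    unfolding inner_vec_sum
  proof (rule sum_mono)
    fix j
    show "h $ j * s $ j \<le> \<bar>h $ j\<bar> / a"
    proof (cases "j = i")
      case True
      have "h $ i * s $ i \<le> 0" using neg S[OF s(1), of i] by (simp add: mult_nonpos_nonneg)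
      also have "0 \<le> \<bar>h $ i\<bar> / a" using a by simp
      finally show ?thesis using True by simp
    next
      case False
      have "s $ j \<le> 1 / a" using s(2)[of j] False r a by (simp add: p_def M_def)
      then have "\<bar>h $ j\<bar> * s $ j \<le> \<bar>h $ j\<bar> * (1 / a)" by (intro mult_left_mono) auto
      moreover have "h $ j * s $ j \<le> \<bar>h $ j\<bar> * s $ j"
        using S[OF s(1), of j] by (intro mult_right_mono) auto
      ultimately show ?thesis by simp
    qed
  qed
  also have "\<dots> = (a - 1) / a" by (simp add: a_def sum_divide_distrib)
  also have "\<dots> < 1" using a by (simp add: field_simps)
  finally show False by simp
qed

text \<open>A positive point with coordinate sum below 1 has all coordinates, hence its product,
  below 1.\<close>

lemma one_in_dual_poly:
  fixes S :: "(real^'n) set"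
  assumes "\<And>s i. s \<in> S \<Longrightarrow> 0 < s $ i" "\<And>s. s \<in> S \<Longrightarrow> 1 \<le> (\<Prod>i\<in>UNIV. s $ i)"
  shows "1 \<in> dual_poly S"
proof -
  have "1 \<le> (\<Sum>i\<in>UNIV. s $ i)" if s: "s \<in> S" for s
  proof (rule ccontr)
    assume neg: "\<not> ?thesis"
    have lt: "s $ i < 1" for i
    proof -
      have "s $ i \<le> (\<Sum>i\<in>UNIV. s $ i)"
        using assms(1)[OF s] by (intro member_le_sum) (auto intro: less_imp_le)
      then show ?thesis using neg by simp
    qed
    fix i :: 'n
    have "(\<Prod>i\<in>UNIV. s $ i) = s $ i * (\<Prod>j\<in>UNIV - {i}. s $ j)" by (simp add: prod.remove)
    also have "\<dots> \<le> s $ i * 1"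
      using assms(1)[OF s] lt by (intro mult_left_mono prod_le_1) (auto intro: less_imp_le)
    also have "\<dots> < 1" using lt by simp
    finally show False using assms(2)[OF s] by simp
  qed
  then show ?thesis by (simp add: dual_poly_def inner_vec_sum)
qed

section \<open>Existence of the decomposition\<close>

lemma compact_norm_one_box:
  "compact {p\<in>norm_one_surface :: (real^'n) set. \<forall>i. exp (- R) \<le> p $ i \<and> p $ i \<le> exp R}"
proof -
  have "{p\<in>norm_one_surface :: (real^'n) set. \<forall>i. exp (- R) \<le> p $ i \<and> p $ i \<le> exp R} =
      {p. (\<Prod>i\<in>UNIV. p $ i) = 1} \<inter> cbox (\<chi> i. exp (- R)) (\<chi> i. exp R)"
    by (auto simp: norm_one_surface_def mem_box_cart) (meson exp_gt_zero less_le_trans)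
  moreover have "closed {p :: real^'n. (\<Prod>i\<in>UNIV. p $ i) = 1}"
    by (intro closed_Collect_eq continuous_intros)
  ultimately show ?thesis by (simp only: closed_Int_compact[OF _ compact_cbox])
qed

text \<open>Modulo \<open>V\<close> the surface is covered by a compact box \<open>D\<close>, hence
  by finitely many \<open>N d\<close>. A generic point is chosen in each open set
  \<open>W d\<close>, slightly above \<open>d\<close> so that its product stays at least 1. One
  factor q is lost in passing from \<open>p\<close> to \<open>d\<close>, another from
  \<open>d\<close> to the chosen point.\<close>

lemma ex_dense_generic:
  fixes V :: "(real^'n) set"
  assumes V: "pos_lattice V" and q: "1 < q"
  shows "\<exists>G. finite G \<and> G \<subseteq> pos_orthant \<and> generic V l G \<and> (\<forall>g\<in>G. 1 \<le> (\<Prod>i\<in>UNIV. g $ i)) \<and>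
    (\<forall>p\<in>norm_one_surface. \<exists>s\<in>orbits V G. \<forall>i. s $ i \<le> (q * q) * p $ i)"
proof -
  have sub: "pos_subgroup V" using V by (simp add: pos_lattice_def)
  obtain R where R: "\<And>p. p \<in> norm_one_surface \<Longrightarrow>
      \<exists>v\<in>V. \<forall>i. exp (- R) \<le> (v * p) $ i \<and> (v * p) $ i \<le> exp R"
    using pos_lattice_cocompact[OF V] by blast
  define D :: "(real^'n) set" where
    "D = {p\<in>norm_one_surface. \<forall>i. exp (- R) \<le> p $ i \<and> p $ i \<le> exp R}"
  have Dpos: "0 < d $ i" if "d \<in> D" for d i using that by (auto simp: D_def norm_one_surface_def)
  define N :: "real^'n \<Rightarrow> (real^'n) set" where "N d = {p. \<forall>i. d $ i < q * p $ i}" for d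
  define W :: "real^'n \<Rightarrow> (real^'n) set" where "W d = {x. \<forall>i. d $ i < x $ i \<and> x $ i < q * d $ i}" for d
  have openN: "open (N d)" for d
  proof -
    have "N d = (\<Inter>i. {p. d $ i < q * p $ i})" by (auto simp: N_def)
    then show ?thesis by (auto intro!: open_INT open_Collect_less continuous_intros)
  qed
  have "D \<subseteq> (\<Union>d\<in>D. N d)" using Dpos q by (auto simp: N_def)
  moreover have "compact D" unfolding D_def by (rule compact_norm_one_box)
  ultimately obtain E where E: "E \<subseteq> D" "finite E" "D \<subseteq> (\<Union>d\<in>E. N d)"
    using openN compactE_image[of D D N] by metis
  have W: "open U \<and> U \<noteq> {}" if U: "U \<in> W ` E" for U
  proof -
    obtain d where that: "d \<in> E" and Ud: "U = W d" using U by blast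
    have "open (W d)"
    proof -
      have "W d = (\<Inter>i. {x. d $ i < x $ i} \<inter> {x. x $ i < q * d $ i})" by (auto simp: W_def)
      then show ?thesis by (auto intro!: open_INT open_Int open_Collect_less continuous_intros)
    qed
    have "d $ i < (1 + q) / 2 * d $ i \<and> (1 + q) / 2 * d $ i < q * d $ i" for i
      using Dpos[of d i] that E(1) q by (auto simp: field_simps)
    then have "((1 + q) / 2) *\<^sub>R d \<in> W d" by (simp add: W_def)
    then show ?thesis using \<open>open (W d)\<close> Ud by blast
  qed
  have "\<exists>G. finite G \<and> G \<subseteq> \<Union>(W ` E) \<and> (\<forall>U\<in>W ` E. G \<inter> U \<noteq> {}) \<and> generic V l G"
    by (rule ex_generic[OF sub pos_lattice_countable[OF V] finite_imageI[OF E(2)]]) (rule W)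
  then obtain G where G: "finite G" "G \<subseteq> \<Union>(W ` E)" "\<forall>U\<in>W ` E. G \<inter> U \<noteq> {}" "generic V l G"
    by (elim exE conjE)
  have Gd: "\<exists>d\<in>D. \<forall>i. d $ i < g $ i" if "g \<in> G" for g
    using that G(2) E(1) by (fastforce simp: W_def)
  have "0 < g $ i" if "g \<in> G" for g i
    using Gd[OF that] Dpos by (meson less_trans)
  moreover have "1 \<le> (\<Prod>i\<in>UNIV. g $ i)" if "g \<in> G" for g
  proof -
    obtain d where d: "d \<in> D" "\<And>i. d $ i < g $ i" using Gd[OF \<open>g \<in> G\<close>] by blast
    have "1 = (\<Prod>i\<in>UNIV. d $ i)" using d by (simp add: D_def norm_one_surface_def)
    also have "\<dots> \<le> (\<Prod>i\<in>UNIV. g $ i)"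
      using d Dpos[OF d(1)] by (intro prod_mono) (auto intro: less_imp_le)
    finally show ?thesis .
  qed
  moreover have "\<exists>s\<in>orbits V G. \<forall>i. s $ i \<le> (q * q) * p $ i" if p: "p \<in> norm_one_surface" for p
  proof -
    obtain v where v: "v \<in> V" "\<And>i. exp (- R) \<le> (v * p) $ i \<and> (v * p) $ i \<le> exp R" using R[OF p] by blast
    have vpos: "0 < v $ i" for i using pos_subgroupD(1)[OF sub v(1)] .
    have "v \<in> norm_one_surface" using pos_lattice_norm_one[OF V] v(1) by blast
    then have "v * p \<in> D" using p v(2) by (auto simp: D_def norm_one_surface_def prod.distrib)
    then obtain d where d: "d \<in> E" "\<And>i. d $ i < q * (v * p) $ i" using E(3) by (auto simp: N_def)
    then obtain g where g: "g \<in> G" "\<And>i. g $ i < q * d $ i" using G(3) by (fastforce simp: W_def)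
    have "(vinv v * g) $ i \<le> (q * q) * p $ i" for i
    proof -
      have "g $ i \<le> q * (q * (v * p) $ i)"
        by (rule order_trans[OF less_imp_le[OF g(2)] mult_left_mono[OF less_imp_le[OF d(2)]]]) (use q in simp)
      then show ?thesis using vpos[of i] by (simp add: field_simps)
    qed
    then show ?thesis using g(1) pos_subgroupD(4)[OF sub v(1)] unfolding orbits_def by blast
  qed
  ultimately show ?thesis using G(1,4) by (intro exI[of _ G]) (auto simp: pos_orthant_def)
qed

theorem proposition1p2:
  fixes V :: "(real^'n) set" and l :: 'n
  assumes "pos_lattice V"
    and "inj_on (\<lambda>v. v $ l) V"
  shows "\<exists>\<B>. effective_shintani_decomposition l V \<B>"
proof -
  have sub: "pos_subgroup V" using assms(1) by (simp add: pos_lattice_def)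
  obtain d where d: "0 < d" "\<forall>v\<in>V. (\<forall>i. \<bar>ln (v $ i)\<bar> \<le> d) \<longrightarrow> v = 1"
    using pos_lattice_discrete[OF assms(1)] by blast
  obtain c where c: "0 < c" "\<forall>y>0. y - 1 - ln y \<le> c \<longrightarrow> \<bar>ln y\<bar> \<le> d / 2"
    using abs_ln_le_of_defect_le[of "d / 2"] d(1) by auto
  \<comment> \<open>Chosen so that n r = n + c, the slack allowed in the AM-GM estimate;
    \<open>q\<close> is its square root because density loses the factor q twice.\<close>
  define r where "r = 1 + c / real CARD('n)"
  define q where "q = sqrt r"
  have r: "1 < r" "real CARD('n) * r = real CARD('n) + c" using c(1) by (simp_all add: r_def distrib_left)
  have q: "1 < q" "q * q = r" using r(1) by (simp_all add: q_def)
  obtain G where G: "finite G" "G \<subseteq> pos_orthant" "generic V l G" "\<forall>g\<in>G. 1 \<le> (\<Prod>i\<in>UNIV. g $ i)"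
    and dense: "\<And>p. p \<in> norm_one_surface \<Longrightarrow> \<exists>s\<in>orbits V G. \<forall>i. s $ i \<le> r * p $ i"
    using ex_dense_generic[OF assms(1) q(1), of l] q(2) by auto
  have Spos: "0 < s $ i" if "s \<in> orbits V G" for s i
    using that pos_subgroupD(1)[OF sub] G(2) by (auto simp: orbits_def pos_orthant_def)
  have Vprod: "(\<Prod>i\<in>UNIV. v $ i) = 1" if "v \<in> V" for v
    using pos_lattice_norm_one[OF assms(1)] that by (auto simp: norm_one_surface_def)
  have Sprod: "1 \<le> (\<Prod>i\<in>UNIV. s $ i)" if "s \<in> orbits V G" for s
    using that G(4) Vprod by (auto simp: orbits_def prod.distrib)
  interpret generic_orbits V l G
  proof
    show "pos_subgroup V" "finite G" "G \<subseteq> pos_orthant" by fact+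
    show "finite {v\<in>V. \<forall>i. v $ i \<le> C}" for C by (rule pos_lattice_finite_bounded[OF assms(1)])
    show "\<not> affine_dependent T" if "finite T" "T \<subseteq> orbits V G" "transversal V T" "card T \<le> Suc CARD('n)" for T
      using G(3) that unfolding generic_def by blast
    show "axis l 1 \<notin> span T" if "finite T" "T \<subseteq> orbits V G" "transversal V T" "card T < CARD('n)" for T
      using G(3) that unfolding generic_def by blast
    show "1 \<in> dual_poly (orbits V G)" using Spos Sprod by (rule one_in_dual_poly)
    show pos: "0 < h $ i" if "h \<in> dual_poly (orbits V G)" for h i
      by (rule dual_pos_of_dense[OF dense Spos that]) (use r in auto)
    show "transversal V (active (orbits V G) h)" if "h \<in> dual_poly (orbits V G)" for h
      by (rule active_transversal_of_dense[OF d(2) pos_subgroupD(1)[OF sub] c(2) dense Spos Sprod that pos[OF that]])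
        (use r in auto)
  qed
  show ?thesis by (rule ex_effective_shintani_decomposition)
qed

end
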